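(* Let $M,N$ be $C^*$-algebras, let $E$ be a $C^*$-correspondence over $M$ and $F$ a $C^*$-correspondence over $N$. Suppose $(E,M)$ and $(F,N)$ are Morita equivalent via an $M,N$-equivalence bimodule $\mathcal{X}$ and a correspondence isomorphism $W:E\otimes_M\mathcal{X}\to\mathcal{X}\otimes_N F$. Suppose further that $\sigma:N\to B(H)$ is a $C^*$-representation on a Hilbert space $H$, and let $\sigma^{\mathcal{X}}:M\to B(\mathcal{X}\otimes_\sigma H)$ be the representation of $M$ induced by $\mathcal{X}$. Then for each $\mathfrak{z}^*\in\overline{\mathbb{D}(F^{\sigma*})}$, the operator $$\mathfrak{z}^{*\mathcal{X}}:=(I_{\mathcal{X}}\otimes\mathfrak{z}^* )(W\otimes I_H)$$ lies in $\overline{\mathbb{D}(E^{\sigma^{\mathcal{X}}*})}$, and the map $\mathfrak{z}^*\mapsto\mathfrak{z}^{*\mathcal{X}}$ is an isometric surjection from $\overline{\mathbb{D}(F^{\sigma*})}$ onto $\overline{\mathbb{D}(E^{\sigma^{\mathcal{X}}*})}$.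
   Context: A $C^*$-correspondence over a $C^*$-algebra $M$ is a right Hilbert $C^*$-module $E$ over $M$ together with a $*$-homomorphism $\varphi_M:M\to\mathcal{L}(E)$ giving the left action, where $\mathcal{L}(E)$ is the algebra of bounded adjointable module maps (similarly $\varphi_N:N\to\mathcal{L}(F)$). Tensor products of correspondences such as $E\otimes_M\mathcal{X}$ are internal (balanced) tensor products; inner products are conjugate linear in the first variable. An $M,N$-equivalence bimodule (Rieffel) $\mathcal{X}$ is an $M$-$N$ bimodule that is a full right Hilbert $C^*$-module over $N$ and whose left action is an isomorphism of $M$ onto the compact operators $\mathcal{K}(\mathcal{X})$ (equivalently, it is also a full left Hilbert $M$-module with compatible inner products). The pairs $(E,M)$ and $(F,N)$ are Morita equivalent via $\mathcal{X}$ if $E\otimes_M\mathcal{X}\simeq\mathcal{X}\otimes_N F$ as $C^*$-correspondences, i.e. there is a bijective $M,N$-bimodule map $W:E\otimes_M\mathcal{X}\to\mathcal{X}\otimes_N F$ preserving the $N$-valued inner products. If $Y$ is a right Hilbert module over a $C^*$-algebra $A$ and $\pi:A\to B(K)$ is a representation, then $Y\otimes_\pi K$ is the Hilbert space obtained as the separated completion of the algebraic tensor product $Y\otimes K$ in the pre-inner product $\langle\xi\otimes h,\eta\otimes k\rangle:=\langle h,\pi(\langle\xi,\eta\rangle)k\rangle$. The induced representation $\pi^Y$ of $\mathcal{L}(Y)$ on $Y\otimes_\pi K$ is $\pi^Y(S):=S\otimes I$. In particular $\sigma^{\mathcal{X}}$ denotes the representation of $M$ on $\mathcal{X}\otimes_\sigma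 H$ in which $a\in M$ acts by (left action of $a$ on $\mathcal{X}$)$\,\otimes I_H$. For a representation $\pi:A\to B(K)$ and a $C^*$-correspondence $Y$ over $A$ with left action $\varphi_A$, the $\pi$-dual of $Y$ is $$Y^\pi:=\{\mathfrak{z}\in B(K,Y\otimes_\pi K)\mid\mathfrak{z}\,\pi(a)=\pi^Y(\varphi_A(a))\,\mathfrak{z}\ \text{ for all }a\in A\},$$ $Y^{\pi*}:=\{\mathfrak{z}^*\mid\mathfrak{z}\in Y^\pi\}\subseteq B(Y\otimes_\pi K,K)$, $\mathbb{D}(Y^{\pi*})$ is the open unit ball of $Y^{\pi*}$ in the operator norm, and $\overline{\mathbb{D}(Y^{\pi*})}$ is its closed unit ball. The operator $I_{\mathcal{X}}\otimes\mathfrak{z}^*$ is the operator from $\mathcal{X}\otimes_{\sigma^F\circ\varphi_N}(F\otimes_\sigma H)$ to $\mathcal{X}\otimes_\sigma H$ given by $x\otimes v\mapsto x\otimes\mathfrak{z}^*v$, and $W\otimes I_H$ is viewed as a map from $E\otimes_{\sigma^{\mathcal{X}}}(\mathcal{X}\otimes_\sigma H)=(E\otimes_M\mathcal{X})\otimes_\sigma H$ to $(\mathcal{X}\otimes_N F)\otimes_\sigma H=\mathcal{X}\otimes_{\sigma^F\circ\varphi_N}(F\otimes_\sigma H)$ using the canonical associativity identifications. Thus $\mathfrak{z}^{*\mathcal{X}}$ maps $E\otimes_{\sigma^{\mathcal{X}}}(\mathcal{X}\otimes_\sigma H)$ to $\mathcal{X}\otimes_\sigma H$.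
   Formalization: It is additionally assumed that σ or the left action of N on F is nondegenerate; otherwise the claim fails, e.g. M=N=X=ℂ, E=0, F=ℂ with zero left action, σ=id⊕0 on ℂ². *)

theory Defs
  imports "HOL-Analysis.Analysis"
begin

section \<open>Complex Banach spaces, Hilbert spaces and C*-algebras\<close>

class scaleC =
  fixes scaleC :: "complex \<Rightarrow> 'a \<Rightarrow> 'a" (infixr "*\<^sub>C" 75)

class cbanach = banach + scaleC +
  assumes scaleC_add_right: "a *\<^sub>C (x + y) = a *\<^sub>C x + a *\<^sub>C y"
    and scaleC_add_left: "(a + b) *\<^sub>C x = a *\<^sub>C x + b *\<^sub>C x"
    and scaleC_scaleC: "a *\<^sub>C b *\<^sub>C x = (a * b) *\<^sub>C x"
    and scaleR_scaleC: "r *\<^sub>R x = complex_of_real r *\<^sub>C x"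
    and norm_scaleC: "norm (a *\<^sub>C x) = cmod a * norm x"

class chilbert_space = cbanach +
  fixes cinner :: "'a \<Rightarrow> 'a \<Rightarrow> complex"
  assumes cinner_add_right: "cinner x (y + z) = cinner x y + cinner x z"
    and cinner_scaleC_right: "cinner x (c *\<^sub>C y) = c * cinner x y"
    and cinner_commute: "cinner y x = cnj (cinner x y)"
    and cinner_norm: "cinner x x = complex_of_real ((norm x)\<^sup>2)"

text \<open>C*-algebras need not have a unit.\<close>

class cstar_algebra = cbanach + real_normed_algebra +
  fixes star :: "'a \<Rightarrow> 'a"
  assumes mult_scaleC_left: "(c *\<^sub>C x) * y = c *\<^sub>C (x * y)"
    and mult_scaleC_right: "x * (c *\<^sub>C y) = c *\<^sub>C (x * y)"
    and star_add: "star (x + y) = star x + star y"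
    and star_scaleC: "star (c *\<^sub>C x) = cnj c *\<^sub>C star x"
    and star_mult: "star (x * y) = star y * star x"
    and star_star: "star (star x) = x"
    and cstar_identity: "norm (star x * x) = (norm x)\<^sup>2"

definition positive :: "'a::cstar_algebra \<Rightarrow> bool" where
  "positive a \<longleftrightarrow> (\<exists>b. a = star b * b)"

definition clinear :: "('a::cbanach \<Rightarrow> 'b::cbanach) \<Rightarrow> bool" where
  "clinear f \<longleftrightarrow> (\<forall>x y. f (x + y) = f x + f y) \<and> (\<forall>c x. f (c *\<^sub>C x) = c *\<^sub>C f x)"

definition cbilinear :: "('a::cbanach \<Rightarrow> 'b::cbanach \<Rightarrow> 'c::cbanach) \<Rightarrow> bool" where
  "cbilinear f \<longleftrightarrow> (\<forall>y. clinear (\<lambda>x. f x y)) \<and> (\<forall>x. clinear (f x))"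

text \<open>\<open>B(K, L)\<close>: the type \<open>'k \<Rightarrow>\<^sub>L 'l\<close> consists of the real-linear bounded maps, with the operator norm.\<close>

definition bounded_ops :: "('k::cbanach \<Rightarrow>\<^sub>L 'l::cbanach) set" where
  "bounded_ops = {T. clinear (blinfun_apply T)}"

definition hadj :: "('k::chilbert_space \<Rightarrow>\<^sub>L 'l::chilbert_space) \<Rightarrow> ('l \<Rightarrow>\<^sub>L 'k)" where
  "hadj T = (THE S :: 'l \<Rightarrow>\<^sub>L 'k. \<forall>x y. cinner (T x) y = cinner x (S y))"

definition star_representation ::
    "('a::cstar_algebra \<Rightarrow> ('k::chilbert_space \<Rightarrow>\<^sub>L 'k)) \<Rightarrow> bool" where
  "star_representation \<pi> \<longleftrightarrow>
     (\<forall>a. \<pi> a \<in> bounded_ops) \<and>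
     (\<forall>a b. \<pi> (a + b) = \<pi> a + \<pi> b) \<and>
     (\<forall>c a k. \<pi> (c *\<^sub>C a) k = c *\<^sub>C \<pi> a k) \<and>
     (\<forall>a b. \<pi> (a * b) = \<pi> a o\<^sub>L \<pi> b) \<and>
     (\<forall>a x y. cinner (\<pi> a x) y = cinner x (\<pi> (star a) y))"

text \<open>
  Here and below the sets whose \<open>span\<close> is taken are closed under multiplication by complex
  scalars, so the real span agrees with the complex one.

  Representations and left actions are not required to be nondegenerate in general; the property is
  imposed separately where it is needed.
\<close>

definition nondegenerate :: "('a::cstar_algebra \<Rightarrow> ('y::cbanach \<Rightarrow>\<^sub>L 'y)) \<Rightarrow> bool" where
  "nondegenerate \<phi> \<longleftrightarrow> closure (span {\<phi> a y |a y. True}) = UNIV"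


section \<open>Hilbert modules and correspondences\<close>

definition hilbert_module ::
    "('y::cbanach \<Rightarrow> 'a::cstar_algebra \<Rightarrow> 'y) \<Rightarrow> ('y \<Rightarrow> 'y \<Rightarrow> 'a) \<Rightarrow> bool" where
  "hilbert_module ract ip \<longleftrightarrow>
     cbilinear ract \<and>
     (\<forall>x a b. ract x (a * b) = ract (ract x a) b) \<and>
     (\<forall>x. clinear (ip x)) \<and>
     (\<forall>x y a. ip x (ract y a) = ip x y * a) \<and>
     (\<forall>x y. ip y x = star (ip x y)) \<and>
     (\<forall>x. positive (ip x x)) \<and>
     (\<forall>x. (norm x)\<^sup>2 = norm (ip x x))"

definition full_module :: "('y \<Rightarrow> 'y \<Rightarrow> 'a::cstar_algebra) \<Rightarrow> bool" where
  "full_module ip \<longleftrightarrow> closure (span {ip x y |x y. True}) = UNIV"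

text \<open>\<open>\<L>(Y)\<close>\<close>

definition adjointable_ops ::
    "('y::cbanach \<Rightarrow> 'a::cstar_algebra \<Rightarrow> 'y) \<Rightarrow> ('y \<Rightarrow> 'y \<Rightarrow> 'a) \<Rightarrow> ('y \<Rightarrow>\<^sub>L 'y) set" where
  "adjointable_ops ract ip =
     {S \<in> bounded_ops. (\<forall>x a. S (ract x a) = ract (S x) a) \<and>
        (\<exists>T :: 'y \<Rightarrow>\<^sub>L 'y. \<forall>x y. ip (S x) y = ip x (T y))}"

text \<open>\<open>\<K>(Y)\<close>\<close>

definition compact_ops ::
    "('y::cbanach \<Rightarrow> 'a::cstar_algebra \<Rightarrow> 'y) \<Rightarrow> ('y \<Rightarrow> 'y \<Rightarrow> 'a) \<Rightarrow> ('y \<Rightarrow>\<^sub>L 'y) set" where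
  "compact_ops ract ip =
     closure (span {T :: 'y \<Rightarrow>\<^sub>L 'y. \<exists>x y. \<forall>z. T z = ract x (ip y z)})"

text \<open>
  A right Hilbert module over \<open>'b\<close> with a left action of \<open>'a\<close> by adjointable operators.
  A C*-correspondence over a C*-algebra is the case where \<open>'a\<close> and \<open>'b\<close> coincide.
\<close>

definition correspondence ::
    "('a::cstar_algebra \<Rightarrow> ('y::cbanach \<Rightarrow>\<^sub>L 'y)) \<Rightarrow> ('y \<Rightarrow> 'b::cstar_algebra \<Rightarrow> 'y)
      \<Rightarrow> ('y \<Rightarrow> 'y \<Rightarrow> 'b) \<Rightarrow> bool" where
  "correspondence \<phi> ract ip \<longleftrightarrow>
     hilbert_module ract ip \<and>
     (\<forall>a. \<phi> a \<in> adjointable_ops ract ip) \<and>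
     (\<forall>a b. \<phi> (a + b) = \<phi> a + \<phi> b) \<and>
     (\<forall>c a y. \<phi> (c *\<^sub>C a) y = c *\<^sub>C \<phi> a y) \<and>
     (\<forall>a b. \<phi> (a * b) = \<phi> a o\<^sub>L \<phi> b) \<and>
     (\<forall>a x y. ip (\<phi> a x) y = ip x (\<phi> (star a) y))"

definition equivalence_bimodule ::
    "('m::cstar_algebra \<Rightarrow> ('x::cbanach \<Rightarrow>\<^sub>L 'x)) \<Rightarrow> ('x \<Rightarrow> 'n::cstar_algebra \<Rightarrow> 'x)
      \<Rightarrow> ('x \<Rightarrow> 'x \<Rightarrow> 'n) \<Rightarrow> bool" where
  "equivalence_bimodule \<phi> ract ip \<longleftrightarrow>
     correspondence \<phi> ract ip \<and> full_module ip \<and>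
     bij_betw \<phi> UNIV (compact_ops ract ip)"

text \<open>
  An isomorphism from \<open>(\<phi>, ract, ip)\<close> to \<open>(\<phi>', ract', ip')\<close>.  A map preserving the inner products is
  isometric, so taking \<open>W\<close> in the type of bounded operators is no restriction.
\<close>

definition correspondence_iso ::
    "('a::cstar_algebra \<Rightarrow> ('y::cbanach \<Rightarrow>\<^sub>L 'y)) \<Rightarrow> ('y \<Rightarrow> 'b::cstar_algebra \<Rightarrow> 'y)
      \<Rightarrow> ('y \<Rightarrow> 'y \<Rightarrow> 'b) \<Rightarrow> ('a \<Rightarrow> ('z::cbanach \<Rightarrow>\<^sub>L 'z)) \<Rightarrow> ('z \<Rightarrow> 'b \<Rightarrow> 'z)
      \<Rightarrow> ('z \<Rightarrow> 'z \<Rightarrow> 'b) \<Rightarrow> ('y \<Rightarrow>\<^sub>L 'z) \<Rightarrow> bool" where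
  "correspondence_iso \<phi> ract ip \<phi>' ract' ip' W \<longleftrightarrow>
     bij (blinfun_apply W) \<and> W \<in> bounded_ops \<and>
     (\<forall>a \<xi>. W (\<phi> a \<xi>) = \<phi>' a (W \<xi>)) \<and>
     (\<forall>\<xi> b. W (ract \<xi> b) = ract' (W \<xi>) b) \<and>
     (\<forall>\<xi> \<eta>. ip' (W \<xi>) (W \<eta>) = ip \<xi> \<eta>)"


section \<open>Tensor products\<close>

text \<open>
  A tensor product is a complete space \<open>'t\<close> together with its map of elementary tensors
  \<open>t y z = y \<otimes> z\<close>.  The predicates below say that \<open>'t\<close>, via \<open>t\<close>, is a separated completion of the
  algebraic tensor product: the bilinear map \<open>t\<close> factors through the algebraic tensor product, the
  resulting linear map carries the prescribed pre-inner product to the inner product of \<open>'t\<close>, and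
  its range is dense.  This determines \<open>('t, t)\<close> up to a unique unitary that respects
  elementary tensors.
\<close>

text \<open>\<open>Y \<otimes>\<^sub>\<pi> K\<close> for a Hilbert module \<open>Y\<close> with inner product \<open>ip\<close> and a representation \<open>\<pi>\<close> on \<open>K\<close>.\<close>

definition hilbert_tensor ::
    "('y::cbanach \<Rightarrow> 'y \<Rightarrow> 'a::cstar_algebra) \<Rightarrow> ('a \<Rightarrow> ('k::chilbert_space \<Rightarrow>\<^sub>L 'k))
      \<Rightarrow> ('y \<Rightarrow> 'k \<Rightarrow> 't::chilbert_space) \<Rightarrow> bool" where
  "hilbert_tensor ip \<pi> t \<longleftrightarrow>
     cbilinear t \<and>
     (\<forall>\<xi> \<eta> h k. cinner (t \<xi> h) (t \<eta> k) = cinner h (\<pi> (ip \<xi> \<eta>) k)) \<and>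
     closure (span {t \<xi> h |\<xi> h. True}) = UNIV"

text \<open>
  The internal tensor product \<open>Y \<otimes>\<^sub>A Z\<close>, as a Hilbert module \<open>(ractT, ipT)\<close> over \<open>'b\<close>, of a Hilbert
  module \<open>Y\<close> over \<open>'a\<close> and a Hilbert module \<open>Z\<close> over \<open>'b\<close> with left action \<open>\<phi>\<close> of \<open>'a\<close>.
\<close>

definition module_tensor ::
    "('y::cbanach \<Rightarrow> 'y \<Rightarrow> 'a::cstar_algebra) \<Rightarrow> ('a \<Rightarrow> ('z::cbanach \<Rightarrow>\<^sub>L 'z))
      \<Rightarrow> ('z \<Rightarrow> 'b::cstar_algebra \<Rightarrow> 'z) \<Rightarrow> ('z \<Rightarrow> 'z \<Rightarrow> 'b)
      \<Rightarrow> ('y \<Rightarrow> 'z \<Rightarrow> 't::cbanach) \<Rightarrow> ('t \<Rightarrow> 'b \<Rightarrow> 't) \<Rightarrow> ('t \<Rightarrow> 't \<Rightarrow> 'b) \<Rightarrow> bool" where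
  "module_tensor ipY \<phi> ractZ ipZ t ractT ipT \<longleftrightarrow>
     hilbert_module ractT ipT \<and> cbilinear t \<and>
     (\<forall>y y' z z'. ipT (t y z) (t y' z') = ipZ z (\<phi> (ipY y y') z')) \<and>
     (\<forall>y z b. ractT (t y z) b = t y (ractZ z b)) \<and>
     closure (span {t y z |y z. True}) = UNIV"

text \<open>
  \<open>S \<otimes> R\<close>: the bounded operator \<open>y \<otimes> k \<mapsto> S y \<otimes> R k\<close> between tensor products with elementary
  tensors \<open>t\<close> and \<open>t'\<close>.
\<close>

definition tensor_op ::
    "('y::cbanach \<Rightarrow> 'k::cbanach \<Rightarrow> 't::cbanach) \<Rightarrow> ('y'::cbanach \<Rightarrow> 'k'::cbanach \<Rightarrow> 't'::cbanach)
      \<Rightarrow> ('y \<Rightarrow>\<^sub>L 'y') \<Rightarrow> ('k \<Rightarrow>\<^sub>L 'k') \<Rightarrow> ('t \<Rightarrow>\<^sub>L 't')" where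
  "tensor_op t t' S R = (THE T :: 't \<Rightarrow>\<^sub>L 't'. T \<in> bounded_ops \<and> (\<forall>y k. T (t y k) = t' (S y) (R k)))"

text \<open>
  The action \<open>a \<mapsto> \<phi> a \<otimes> I\<close> on a tensor product: the left action on \<open>Y \<otimes>\<^sub>A Z\<close>, and the composite
  \<open>\<pi>\<^sup>Y \<circ> \<phi>\<close> of the induced representation with the left action on \<open>Y \<otimes>\<^sub>\<pi> K\<close>.
\<close>

definition induced ::
    "('y::cbanach \<Rightarrow> 'k::cbanach \<Rightarrow> 't::cbanach) \<Rightarrow> ('a \<Rightarrow> ('y \<Rightarrow>\<^sub>L 'y)) \<Rightarrow> 'a \<Rightarrow> ('t \<Rightarrow>\<^sub>L 't)" where
  "induced t \<phi> a = tensor_op t t (\<phi> a) id_blinfun"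

text \<open>
  The canonical identifications \<open>(Y \<otimes> Z) \<otimes> K \<rightarrow> Y \<otimes> (Z \<otimes> K)\<close> and \<open>Y \<otimes> (Z \<otimes> K) \<rightarrow> (Y \<otimes> Z) \<otimes> K\<close>.
  The arguments are the elementary tensors of \<open>Y \<otimes> Z\<close>, \<open>(Y \<otimes> Z) \<otimes> K\<close>, \<open>Z \<otimes> K\<close>, \<open>Y \<otimes> (Z \<otimes> K)\<close>.
\<close>

definition assoc_right ::
    "('y \<Rightarrow> 'z \<Rightarrow> 'yz) \<Rightarrow> ('yz \<Rightarrow> 'k \<Rightarrow> 's::cbanach) \<Rightarrow> ('z \<Rightarrow> 'k \<Rightarrow> 'zk) \<Rightarrow> ('y \<Rightarrow> 'zk \<Rightarrow> 't::cbanach)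
      \<Rightarrow> ('s \<Rightarrow>\<^sub>L 't)" where
  "assoc_right tYZ tYZ_K tZK tY_ZK =
     (THE T :: 's \<Rightarrow>\<^sub>L 't. T \<in> bounded_ops \<and> (\<forall>y z k. T (tYZ_K (tYZ y z) k) = tY_ZK y (tZK z k)))"

definition assoc_left ::
    "('y \<Rightarrow> 'z \<Rightarrow> 'yz) \<Rightarrow> ('yz \<Rightarrow> 'k \<Rightarrow> 's::cbanach) \<Rightarrow> ('z \<Rightarrow> 'k \<Rightarrow> 'zk) \<Rightarrow> ('y \<Rightarrow> 'zk \<Rightarrow> 't::cbanach)
      \<Rightarrow> ('t \<Rightarrow>\<^sub>L 's)" where
  "assoc_left tYZ tYZ_K tZK tY_ZK =
     (THE T :: 't \<Rightarrow>\<^sub>L 's. T \<in> bounded_ops \<and> (\<forall>y z k. T (tY_ZK y (tZK z k)) = tYZ_K (tYZ y z) k))"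


section \<open>Duals\<close>

text \<open>\<open>Y\<^sup>\<pi>\<close>, where \<open>t\<close> gives the elementary tensors of \<open>Y \<otimes>\<^sub>\<pi> K\<close>.\<close>

definition dual ::
    "('a::cstar_algebra \<Rightarrow> ('k::chilbert_space \<Rightarrow>\<^sub>L 'k)) \<Rightarrow> ('a \<Rightarrow> ('y::cbanach \<Rightarrow>\<^sub>L 'y))
      \<Rightarrow> ('y \<Rightarrow> 'k \<Rightarrow> 't::chilbert_space) \<Rightarrow> ('k \<Rightarrow>\<^sub>L 't) set" where
  "dual \<pi> \<phi> t = {z \<in> bounded_ops. \<forall>a. z o\<^sub>L \<pi> a = induced t \<phi> a o\<^sub>L z}"

text \<open>The closed unit ball of \<open>Y\<^sup>\<pi>\<^sup>*\<close>.\<close>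

definition dual_adj_ball ::
    "('a::cstar_algebra \<Rightarrow> ('k::chilbert_space \<Rightarrow>\<^sub>L 'k)) \<Rightarrow> ('a \<Rightarrow> ('y::cbanach \<Rightarrow>\<^sub>L 'y))
      \<Rightarrow> ('y \<Rightarrow> 'k \<Rightarrow> 't::chilbert_space) \<Rightarrow> ('t \<Rightarrow>\<^sub>L 'k) set" where
  "dual_adj_ball \<pi> \<phi> t = hadj ` dual \<pi> \<phi> t \<inter> cball 0 1"

end

theory Submission
  imports Defs
begin

text \<open>
  Since the left action of \<open>M\<close> maps onto \<open>\<K>(X)\<close>, an operator \<open>R : X \<otimes> K\<^sub>1 \<rightarrow> X \<otimes> K\<^sub>2\<close> intertwining the
  actions of \<open>M\<close> commutes with all \<open>x\<langle>y, -\<rangle> \<otimes> I\<close>, and hence has the form \<open>I \<otimes> Z\<close> with \<open>Z\<close> intertwining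
  the representations of \<open>N\<close> and \<open>norm Z \<le> norm R\<close>.  Composition with the unitary \<open>W \<otimes> I\<close>, which
  intertwines the two actions of \<open>M\<close>, then gives the bijection between the unit balls.

  All boundedness statements rest on one estimate: if \<open>\<langle>f i, f j\<rangle> = \<langle>g i, g (p j)\<rangle>\<close> for a map \<open>p\<close> that
  is symmetric for the Gram kernel of \<open>g\<close>, then iterating
  \<open>(norm (P \<xi>))\<^sup>2 \<le> norm \<xi> * norm (P (P \<xi>))\<close> bounds \<open>\<Sum>i. f i\<close> by \<open>\<Sum>i. g i\<close>.  This replaces the order
  structure of C*-algebras throughout.
\<close>

section \<open>Complex linear maps\<close>

text \<open>The obstacle is existence. Tensor products are given only by a Gram kernel and a dense
  span, operators on them only by \<open>THE\<close>, so S \<otimes> R, I \<otimes> Z and the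
  associativity maps must first be shown bounded on finite sums of elementary tensors. The natural
  candidate for the squared modulus, S* S \<otimes> R* R, is not yet an operator at that point; it
  is available only as a map on the indices. The iteration needs no more than that, together with
  geometric growth of the single vectors. Their multiplicative constant disappears under repeated
  square roots, so rough bounds on y \<otimes> k suffice. Those rest on automatic continuity in the
  algebra variable, which is not assumed of representations and left actions. In Hilbert spaces the
  Cauchy-Schwarz constant is 1 and the estimate is sharp: it gives norm (I \<otimes> Z) \<le> norm Z
  and, used for the inverse construction, the opposite inequality. In Hilbert modules a constant
  remains, but there only the existence of the induced action matters.\<close>

lemma scaleC_one [simp]: "1 *\<^sub>C x = (x::'a::cbanach)"
  using scaleR_scaleC[of 1 x] by simp

lemma scaleC_zero_left [simp]: "0 *\<^sub>C x = (0::'a::cbanach)"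
  using scaleR_scaleC[of 0 x] by simp

lemma scaleC_zero_right [simp]: "c *\<^sub>C 0 = (0::'a::cbanach)"
  using norm_scaleC[of c "0::'a"] by simp

lemma scaleC_minus_one: "(-1) *\<^sub>C x = - (x::'a::cbanach)"
  using scaleR_scaleC[of "-1" x] by simp

lemma scaleC_minus_left: "(- c) *\<^sub>C x = - (c *\<^sub>C (x::'a::cbanach))"
  using scaleC_scaleC[of "-1" c x] by (simp add: scaleC_minus_one)

lemma scaleC_minus_right: "c *\<^sub>C (- x) = - (c *\<^sub>C (x::'a::cbanach))"
  using scaleC_scaleC[of c "-1" x] by (simp add: scaleC_minus_one scaleC_minus_left)

lemma scaleC_diff_right: "c *\<^sub>C (x - y) = c *\<^sub>C x - c *\<^sub>C (y::'a::cbanach)"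
  using scaleC_add_right[of c x "-y"] by (simp add: scaleC_minus_right)

lemma bounded_linear_scaleC: "bounded_linear (\<lambda>x::'a::cbanach. c *\<^sub>C x)"
  by (rule bounded_linear_intro[where K = "cmod c"])
     (simp_all add: scaleC_add_right scaleR_scaleC scaleC_scaleC norm_scaleC mult.commute)

lemma clinear_add: "clinear f \<Longrightarrow> f (x + y) = f x + f y"
  by (simp add: clinear_def)

lemma clinear_scaleC: "clinear f \<Longrightarrow> f (c *\<^sub>C x) = c *\<^sub>C f x"
  by (simp add: clinear_def)

lemma clinear_linear: "clinear f \<Longrightarrow> linear f"
  by (rule linearI) (simp_all add: clinear_def scaleR_scaleC)

lemma clinear_bounded_linear:
  assumes "clinear f" and "\<And>x. norm (f x) \<le> norm x * B"
  shows "bounded_linear f"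
  by (rule bounded_linear_intro[where K = B])
     (use assms in \<open>simp_all add: clinear_def scaleR_scaleC\<close>)

lemma clinear_Blinfun:
  assumes "clinear f" and "\<And>x. norm (f x) \<le> norm x * B"
  shows "blinfun_apply (Blinfun f) = f" and "Blinfun f \<in> bounded_ops"
  using assms bounded_linear_Blinfun_apply[OF clinear_bounded_linear[OF assms]]
  by (simp_all add: bounded_ops_def)

lemma bounded_ops_scaleC: "T \<in> bounded_ops \<Longrightarrow> T (c *\<^sub>C x) = c *\<^sub>C T x"
  by (simp add: bounded_ops_def clinear_def)

lemma bounded_ops_id [simp]: "id_blinfun \<in> bounded_ops"
  by (simp add: bounded_ops_def clinear_def)

lemma bounded_ops_compose: "S \<in> bounded_ops \<Longrightarrow> T \<in> bounded_ops \<Longrightarrow> S o\<^sub>L T \<in> bounded_ops"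
  by (simp add: bounded_ops_def clinear_def)

lemma bounded_ops_diff: "S \<in> bounded_ops \<Longrightarrow> T \<in> bounded_ops \<Longrightarrow> S - T \<in> bounded_ops"
  by (simp add: bounded_ops_def clinear_def blinfun.diff_left scaleC_diff_right algebra_simps)

lemma norm_blinfun_funpow:
  fixes P :: "'a::real_normed_vector \<Rightarrow>\<^sub>L 'a"
  shows "norm ((blinfun_apply P ^^ n) y) \<le> norm P ^ n * norm y"
proof (induction n)
  case (Suc n)
  have "norm (P ((blinfun_apply P ^^ n) y)) \<le> norm P * (norm P ^ n * norm y)"
    using norm_blinfun[of P "(blinfun_apply P ^^ n) y"] Suc
    by (meson mult_left_mono norm_ge_zero order_trans)
  then show ?case by (simp add: mult.assoc)
qed simp

lemma cbilinear_scaleC_left: "cbilinear t \<Longrightarrow> t (c *\<^sub>C y) z = c *\<^sub>C t y z"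
  and cbilinear_add_left: "cbilinear t \<Longrightarrow> t (y + y') z = t y z + t y' z"
  by (simp_all add: cbilinear_def clinear_def)

section \<open>Closed spans and operators given on dense spans\<close>

lemma subspace_closure:
  fixes S :: "'a::real_normed_vector set"
  assumes S: "subspace S"
  shows "subspace (closure S)"
proof (rule subspaceI)
  show "0 \<in> closure S" using subspace_0[OF S] closure_subset by blast
next
  fix x y assume "x \<in> closure S" "y \<in> closure S"
  then obtain u v where "\<And>n::nat. u n \<in> S" "u \<longlonglongrightarrow> x" "\<And>n::nat. v n \<in> S" "v \<longlonglongrightarrow> y"
    unfolding closure_sequential by blast
  then show "x + y \<in> closure S"
    unfolding closure_sequential
    by (intro exI[of _ "\<lambda>n. u n + v n"]) (simp add: subspace_add[OF S] tendsto_add)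
next
  fix r x assume "x \<in> closure S"
  then obtain u where "\<And>n::nat. u n \<in> S" "u \<longlonglongrightarrow> x"
    unfolding closure_sequential by blast
  then show "r *\<^sub>R x \<in> closure S"
    unfolding closure_sequential
    by (intro exI[of _ "\<lambda>n. r *\<^sub>R u n"]) (simp add: subspace_scale[OF S] tendsto_scaleR)
qed

lemma in_closure_span: "x \<in> A \<Longrightarrow> x \<in> closure (span A)"
  by (meson closure_subset span_base subsetD)

lemma closure_span_least:
  fixes A B :: "'a::real_normed_vector set"
  assumes "A \<subseteq> closure (span B)"
  shows "closure (span A) \<subseteq> closure (span B)"
  by (intro closure_minimal span_minimal assms closed_closure subspace_closure subspace_span)

lemma closure_span_image:
  assumes "bounded_linear f" and "x \<in> closure (span A)" and "\<And>a. a \<in> A \<Longrightarrow> f a \<in> closure (span B)"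
  shows "f x \<in> closure (span B)"
proof -
  interpret bounded_linear f by fact
  have "f ` closure (span A) \<subseteq> closure (f ` span A)"
    by (intro image_closure_subset continuous_on closure_subset closed_closure)
       (auto intro: tendsto_intros tendsto)
  also have "\<dots> = closure (span (f ` A))"
    by (simp add: linear_span_image linear_axioms)
  also have "\<dots> \<subseteq> closure (span B)"
    using assms(3) by (intro closure_span_least) blast
  finally show ?thesis using assms(2) by blast
qed

lemma blinfun_eq_on_dense:
  fixes S T :: "'a::real_normed_vector \<Rightarrow>\<^sub>L 'b::real_normed_vector"
  assumes "closure (span A) = UNIV" and "\<And>x. x \<in> A \<Longrightarrow> S x = T x"
  shows "S = T"
proof (rule blinfun_eqI)
  fix x
  have "(S - T) x \<in> closure (span {0})"
    by (rule closure_span_image[OF blinfun.bounded_linear_right, where A = A])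
       (use assms in \<open>simp_all add: blinfun.diff_left\<close>)
  then show "S x = T x" by (simp add: blinfun.diff_left)
qed

text \<open>The extension is the operator whose graph is the closure of the set of pairs
  \<open>(\<Sum>i\<leftarrow>l. g i, \<Sum>i\<leftarrow>l. f i)\<close>.\<close>

lemma bounded_extension:
  fixes g :: "'i \<Rightarrow> 't::cbanach" and f :: "'i \<Rightarrow> 's::cbanach"
  assumes dense: "closure (span (range g)) = UNIV"
    and scale: "\<And>c i. \<exists>j. g j = c *\<^sub>C g i \<and> f j = c *\<^sub>C f i"
    and bound: "\<And>l. norm (\<Sum>i\<leftarrow>l. f i) \<le> C * norm (\<Sum>i\<leftarrow>l. g i)"
    and C: "0 \<le> C"
  shows "\<exists>T::'t \<Rightarrow>\<^sub>L 's. T \<in> bounded_ops \<and> (\<forall>i. T (g i) = f i) \<and> norm T \<le> C"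
proof -
  define \<Gamma> where "\<Gamma> = range (\<lambda>l. (\<Sum>i\<leftarrow>l. g i, \<Sum>i\<leftarrow>l. f i))"
  have scale_list: "\<exists>m. (\<Sum>i\<leftarrow>m. g i) = c *\<^sub>C (\<Sum>i\<leftarrow>l. g i) \<and> (\<Sum>i\<leftarrow>m. f i) = c *\<^sub>C (\<Sum>i\<leftarrow>l. f i)"
    for c l
  proof (induction l)
    case Nil
    show ?case by (rule exI[of _ "[]"]) simp
  next
    case (Cons i l)
    obtain m j where "(\<Sum>i\<leftarrow>m. g i) = c *\<^sub>C (\<Sum>i\<leftarrow>l. g i)" "(\<Sum>i\<leftarrow>m. f i) = c *\<^sub>C (\<Sum>i\<leftarrow>l. f i)"
      "g j = c *\<^sub>C g i" "f j = c *\<^sub>C f i"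
      using Cons scale by blast
    then show ?case by (intro exI[of _ "j # m"]) (simp add: scaleC_add_right)
  qed
  \<comment> \<open>\<open>subspace\<close> and \<open>span\<close> are real, so closure under
    complex scalars is carried along as a separate invariant of \<open>\<Gamma>\<close> and later of
    its closure.\<close>
  have scale_\<Gamma>: "(c *\<^sub>C x, c *\<^sub>C y) \<in> \<Gamma>" if xy: "(x, y) \<in> \<Gamma>" for c x y
  proof -
    obtain l where "x = (\<Sum>i\<leftarrow>l. g i)" "y = (\<Sum>i\<leftarrow>l. f i)" using xy unfolding \<Gamma>_def by blast
    moreover obtain m where "(\<Sum>i\<leftarrow>m. g i) = c *\<^sub>C (\<Sum>i\<leftarrow>l. g i)" "(\<Sum>i\<leftarrow>m. f i) = c *\<^sub>C (\<Sum>i\<leftarrow>l. f i)"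
      using scale_list by blast
    ultimately show ?thesis unfolding \<Gamma>_def by (intro image_eqI[of _ _ m]) simp_all
  qed
  have sub: "subspace \<Gamma>"
  proof (rule subspaceI)
    show "0 \<in> \<Gamma>" unfolding \<Gamma>_def by (rule image_eqI[of _ _ "[]"]) (simp_all add: zero_prod_def)
    fix p q assume "p \<in> \<Gamma>" "q \<in> \<Gamma>"
    then obtain l m where "p = (\<Sum>i\<leftarrow>l. g i, \<Sum>i\<leftarrow>l. f i)" "q = (\<Sum>i\<leftarrow>m. g i, \<Sum>i\<leftarrow>m. f i)"
      unfolding \<Gamma>_def by blast
    then show "p + q \<in> \<Gamma>" unfolding \<Gamma>_def by (intro image_eqI[of _ _ "l @ m"]) simp_all
  next
    fix r p assume "p \<in> \<Gamma>"
    then show "r *\<^sub>R p \<in> \<Gamma>"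
      using scale_\<Gamma>[of "fst p" "snd p" "complex_of_real r"]
      by (simp add: scaleR_prod_def scaleR_scaleC)
  qed
  define G where "G = closure \<Gamma>"
  have sub_G: "subspace G" unfolding G_def by (intro subspace_closure sub)
  have \<Gamma>_bound: "norm (snd p) \<le> C * norm (fst p)" if "p \<in> \<Gamma>" for p
    using that bound unfolding \<Gamma>_def by auto
  have "G \<subseteq> {p. norm (snd p) \<le> C * norm (fst p)}"
    unfolding G_def
    by (intro closure_minimal closed_Collect_le continuous_intros) (use \<Gamma>_bound in auto)
  then have G_bound: "norm y \<le> C * norm x" if "(x, y) \<in> G" for x y
    using that by auto
  have G_scale: "(c *\<^sub>C x, c *\<^sub>C y) \<in> G" if xy: "(x, y) \<in> G" for c x y
  proof -
    obtain p where p: "\<And>n. p n \<in> \<Gamma>" "p \<longlonglongrightarrow> (x, y)"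
      using xy unfolding G_def closure_sequential by blast
    have "(\<lambda>n. (c *\<^sub>C fst (p n), c *\<^sub>C snd (p n))) \<longlonglongrightarrow> (c *\<^sub>C x, c *\<^sub>C y)"
      using tendsto_fst[OF p(2)] tendsto_snd[OF p(2)]
      by (intro tendsto_Pair bounded_linear.tendsto[OF bounded_linear_scaleC]) simp_all
    then show ?thesis
      unfolding G_def closure_sequential using p(1) scale_\<Gamma> by (intro exI conjI) auto
  qed
  \<comment> \<open>Completeness of the target enters here: along first components converging to x,
    the bound makes the second components Cauchy.\<close>
  have total: "\<exists>y. (x, y) \<in> G" for x
  proof -
    have "range g \<subseteq> fst ` \<Gamma>"
    proof
      fix u assume "u \<in> range g"
      then obtain i where "u = g i" by blast
      then show "u \<in> fst ` \<Gamma>"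
        unfolding \<Gamma>_def image_image by (intro image_eqI[of _ _ "[i]"]) simp_all
    qed
    moreover have "subspace (fst ` \<Gamma>)"
      using linear_subspace_image[OF linear_fst sub] .
    ultimately have "closure (span (range g)) \<subseteq> closure (fst ` \<Gamma>)"
      by (intro closure_mono span_minimal)
    then have "x \<in> closure (fst ` \<Gamma>)" using dense by blast
    then obtain u where u: "\<And>n::nat. u n \<in> fst ` \<Gamma>" "u \<longlonglongrightarrow> x"
      unfolding closure_sequential by blast
    have "\<exists>w. (u n, w) \<in> \<Gamma>" for n
      using u(1)[of n] by (metis imageE prod.collapse)
    then obtain v where v: "\<And>n. (u n, v n) \<in> \<Gamma>" by metis
    have dist_v: "norm (v m - v n) \<le> C * norm (u m - u n)" for m n
      using \<Gamma>_bound[OF subspace_diff[OF sub v[of m] v[of n]]] by simp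
    have "Cauchy v"
    proof (rule metric_CauchyI)
      fix e :: real assume e: "e > 0"
      \<comment> \<open>C may be 0, hence the denominator C + 1.\<close>
      have "e / (C + 1) > 0" using e C by simp
      from metric_CauchyD[OF LIMSEQ_imp_Cauchy[OF u(2)] this]
      obtain M where M: "\<And>m n. m \<ge> M \<Longrightarrow> n \<ge> M \<Longrightarrow> dist (u m) (u n) < e / (C + 1)"
        by blast
      have "dist (v m) (v n) < e" if "m \<ge> M" "n \<ge> M" for m n
      proof -
        have "dist (v m) (v n) \<le> (C + 1) * dist (u m) (u n)"
          using dist_v[of m n] norm_ge_zero[of "u m - u n"] unfolding dist_norm distrib_right
          by linarith
        also have "\<dots> < e" using M[OF that] C by (simp add: pos_less_divide_eq mult.commute)
        finally show ?thesis .
      qed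
      then show "\<exists>M. \<forall>m\<ge>M. \<forall>n\<ge>M. dist (v m) (v n) < e" by blast
    qed
    then obtain y where "v \<longlonglongrightarrow> y" using Cauchy_convergent convergent_def by blast
    then have "(x, y) \<in> G"
      unfolding G_def closure_sequential using v u(2)
      by (intro exI[of _ "\<lambda>n. (u n, v n)"]) (auto intro: tendsto_Pair)
    then show ?thesis ..
  qed
  have unique: "y = z" if "(x, y) \<in> G" "(x, z) \<in> G" for x y z
    using G_bound[of 0 "y - z"] subspace_diff[OF sub_G that] by simp
  define F where "F x = (THE y. (x, y) \<in> G)" for x
  have F_in: "(x, F x) \<in> G" for x
    unfolding F_def using total unique by (metis theI)
  have F_eq: "F x = y" if "(x, y) \<in> G" for x y
    using F_in that unique by blast
  have lin: "clinear F"
    unfolding clinear_def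
    using subspace_add[OF sub_G F_in F_in] G_scale[OF F_in] by (auto intro!: F_eq)
  have bd: "norm (F x) \<le> norm x * C" for x
    using G_bound[OF F_in] by (simp add: mult.commute)
  have gen: "F (g i) = f i" for i
  proof (rule F_eq)
    have "(g i, f i) \<in> \<Gamma>" unfolding \<Gamma>_def by (rule image_eqI[of _ _ "[i]"]) simp_all
    then show "(g i, f i) \<in> G" unfolding G_def using closure_subset by blast
  qed
  show ?thesis
    using clinear_Blinfun[OF lin bd] gen bd C
    by (intro exI[of _ "Blinfun F"]) (auto intro!: norm_blinfun_bound simp: mult.commute)
qed

section \<open>Complex Hilbert spaces and adjoints\<close>

lemma cinner_add_left: "cinner (x + y) z = cinner x z + cinner y (z::'a::chilbert_space)"
  by (metis cinner_add_right cinner_commute complex_cnj_add)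

lemma cinner_scaleC_left: "cinner (c *\<^sub>C x) y = cnj c * cinner x (y::'a::chilbert_space)"
  by (metis cinner_commute cinner_scaleC_right complex_cnj_mult)

lemma cinner_scaleR_right: "cinner x (r *\<^sub>R y) = of_real r * cinner x (y::'a::chilbert_space)"
  by (simp add: scaleR_scaleC cinner_scaleC_right)

lemma cinner_scaleR_left: "cinner (r *\<^sub>R x) y = of_real r * cinner x (y::'a::chilbert_space)"
  by (simp add: scaleR_scaleC cinner_scaleC_left)

lemma cinner_minus_right: "cinner x (- y) = - cinner x (y::'a::chilbert_space)"
  using cinner_scaleR_right[of x "-1" y] by simp

lemma cinner_minus_left: "cinner (- x) y = - cinner x (y::'a::chilbert_space)"
  using cinner_scaleR_left[of "-1" x y] by simp

lemma cinner_diff_right: "cinner x (y - z) = cinner x y - cinner x (z::'a::chilbert_space)"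
  using cinner_add_right[of x y "-z"] by (simp add: cinner_minus_right)

lemma cinner_diff_left: "cinner (x - y) z = cinner x z - cinner y (z::'a::chilbert_space)"
  using cinner_add_left[of x "-y" z] by (simp add: cinner_minus_left)

lemma cinner_zero [simp]:
  "cinner 0 y = 0" "cinner y 0 = (0::complex)" for y :: "'a::chilbert_space"
  using cinner_diff_left[of y y y] cinner_diff_right[of y y y] by simp_all

lemma norm_add_sq:
  "(norm (x + y))\<^sup>2 = (norm x)\<^sup>2 + 2 * Re (cinner x y) + (norm (y::'a::chilbert_space))\<^sup>2"
proof -
  have "complex_of_real ((norm (x + y))\<^sup>2) = cinner (x + y) (x + y)"
    by (simp add: cinner_norm)
  also have "\<dots> = cinner x x + (cinner x y + cnj (cinner x y)) + cinner y y"
    by (simp add: cinner_add_left cinner_add_right cinner_commute[of x y])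
  also have "\<dots> = complex_of_real ((norm x)\<^sup>2 + 2 * Re (cinner x y) + (norm y)\<^sup>2)"
    by (simp add: cinner_norm complex_add_cnj)
  finally show ?thesis using of_real_eq_iff by blast
qed

lemma cinner_Cauchy_Schwarz: "cmod (cinner x y) \<le> norm x * norm (y::'a::chilbert_space)"
proof (cases "y = 0")
  case False
  define c where "c = cinner y x / of_real ((norm y)\<^sup>2)"
  have "0 \<le> (norm (x + (- c) *\<^sub>C y))\<^sup>2" by simp
  also have "\<dots> = (norm x)\<^sup>2 + 2 * Re (cinner x ((- c) *\<^sub>C y)) + (norm ((- c) *\<^sub>C y))\<^sup>2"
    by (rule norm_add_sq)
  also have "cinner x ((- c) *\<^sub>C y) = - of_real ((cmod (cinner x y))\<^sup>2 / (norm y)\<^sup>2)"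
  proof -
    have "cinner y x * cinner x y = of_real ((cmod (cinner x y))\<^sup>2)"
      by (subst cinner_commute) (metis complex_norm_square mult.commute)
    then show ?thesis by (simp add: c_def cinner_scaleC_right)
  qed
  also have "norm ((- c) *\<^sub>C y) = cmod (cinner x y) / norm y"
    using False by (simp add: norm_scaleC c_def norm_divide cinner_commute[of x y] power2_eq_square norm_mult)
  finally have "(cmod (cinner x y))\<^sup>2 / (norm y)\<^sup>2 \<le> (norm x)\<^sup>2"
    by (simp add: power_divide flip: of_real_power of_real_divide)
  then have "(cmod (cinner x y))\<^sup>2 \<le> (norm x * norm y)\<^sup>2"
    using False by (simp add: pos_divide_le_eq power_mult_distrib)
  then show ?thesis by (rule power2_le_imp_le) simp
qed simp

lemma cinner_ext: "(\<And>x. cinner x y = cinner x z) \<Longrightarrow> y = (z::'a::chilbert_space)"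
proof -
  assume "\<And>x. cinner x y = cinner x z"
  then have "cinner (y - z) (y - z) = 0" by (simp add: cinner_diff_right)
  then show "y = z" by (simp add: cinner_norm)
qed

text \<open>The representing vector minimizes \<open>(norm x)\<^sup>2 - 2 * Re (f x)\<close>; by the parallelogram law
  every minimizing sequence is Cauchy.\<close>

lemma riesz_representation:
  fixes f :: "'k::chilbert_space \<Rightarrow> complex"
  assumes add: "\<And>x y. f (x + y) = f x + f y" and scale: "\<And>c x. f (c *\<^sub>C x) = c * f x"
    and bound: "\<And>x. cmod (f x) \<le> B * norm x"
  shows "\<exists>v. \<forall>x. f x = cinner v x"
proof -
  define J where "J x = (norm x)\<^sup>2 - 2 * Re (f x)" for x
  have fR: "f (r *\<^sub>R x) = of_real r * f x" for r x
    by (simp add: scaleR_scaleC scale)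
  have J_ge: "- (B\<^sup>2) \<le> J x" for x
  proof -
    have "Re (f x) \<le> B * norm x" using bound complex_Re_le_cmod order_trans by blast
    moreover have "0 \<le> (norm x - B)\<^sup>2" by simp
    ultimately show ?thesis unfolding J_def by (simp add: power2_diff algebra_simps)
  qed
  have bdd: "bdd_below (range J)" using J_ge by (intro bdd_belowI) auto
  define m where "m = Inf (range J)"
  have m_le: "m \<le> J x" for x unfolding m_def by (intro cInf_lower bdd) simp
  have "\<exists>x. J x < m + 1 / real (Suc n)" for n
    using cInf_lessD[of "range J" "m + 1 / real (Suc n)"] unfolding m_def by auto
  then obtain u where u: "\<And>n. J (u n) < m + 1 / real (Suc n)" by metis
  have para: "(norm (x - y))\<^sup>2 = 2 * (J x - m) + 2 * (J y - m) - 4 * (J ((1/2) *\<^sub>R (x + y)) - m)" for x y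
  proof -
    have 1: "Re (f ((1/2) *\<^sub>R (x + y))) = (Re (f x) + Re (f y)) / 2"
      by (simp only: fR add) simp
    have 2: "(norm ((1/2) *\<^sub>R (x + y)))\<^sup>2 = (norm (x + y))\<^sup>2 / 4"
      by (simp add: power_divide)
    have "(norm (x - y))\<^sup>2 = 2 * (norm x)\<^sup>2 + 2 * (norm y)\<^sup>2 - (norm (x + y))\<^sup>2"
      using norm_add_sq[of x "-y"] norm_add_sq[of x y] by (simp add: cinner_minus_right)
    then show ?thesis unfolding J_def 1 2 by (simp add: algebra_simps)
  qed
  have "Cauchy u"
  proof (rule metric_CauchyI)
    fix e :: real assume e: "e > 0"
    obtain M where M: "inverse (real (Suc M)) < e\<^sup>2 / 4"
      using reals_Archimedean[of "e\<^sup>2 / 4"] e by auto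
    have "dist (u p) (u q) < e" if "p \<ge> M" "q \<ge> M" for p q
    proof -
      have "1 / real (Suc p) \<le> 1 / real (Suc M)" "1 / real (Suc q) \<le> 1 / real (Suc M)"
        using that by (simp_all add: frac_le)
      then have "J (u p) - m < 1 / real (Suc M)" "J (u q) - m < 1 / real (Suc M)"
        using u[of p] u[of q] by linarith+
      then have "(norm (u p - u q))\<^sup>2 < 4 * (1 / real (Suc M))"
        unfolding para[of "u p" "u q"] using m_le[of "(1/2) *\<^sub>R (u p + u q)"] by argo
      also have "\<dots> < e\<^sup>2" using M by (simp add: inverse_eq_divide)
      finally show ?thesis unfolding dist_norm using e power2_less_imp_less by fastforce
    qed
    then show "\<exists>M. \<forall>p\<ge>M. \<forall>q\<ge>M. dist (u p) (u q) < e" by blast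
  qed
  then obtain v where v: "u \<longlonglongrightarrow> v" using Cauchy_convergent convergent_def by blast
  have Re_bl: "bounded_linear (\<lambda>x. Re (f x))"
  proof (rule bounded_linear_intro[where K = B])
    show "norm (Re (f x)) \<le> norm x * B" for x
      using abs_Re_le_cmod[of "f x"] bound[of x] by (simp add: mult.commute)
  qed (simp_all add: add fR)
  have "(\<lambda>n. J (u n)) \<longlonglongrightarrow> J v"
    unfolding J_def by (intro tendsto_intros v bounded_linear.tendsto[OF Re_bl])
  moreover have "(\<lambda>n. m + 1 / real (Suc n)) \<longlonglongrightarrow> m + 0"
    using LIMSEQ_inverse_real_of_nat
    by (intro tendsto_add tendsto_const) (simp add: inverse_eq_divide)
  ultimately have Jv: "J v \<le> m"
    using u by (intro LIMSEQ_le[of "\<lambda>n. J (u n)"]) (auto intro: less_imp_le)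
  have Re_eq: "Re (f x) = Re (cinner v x)" for x
  proof -
    define d where "d = Re (cinner v x) - Re (f x)"
    have "0 \<le> t\<^sup>2 * (norm x)\<^sup>2 + 2 * t * d" for t
    proof -
      have "J (v + t *\<^sub>R x) = J v + (t\<^sup>2 * (norm x)\<^sup>2 + 2 * t * d)"
        unfolding J_def d_def norm_add_sq add fR cinner_scaleR_right
        by (simp add: power_mult_distrib algebra_simps)
      then show ?thesis using m_le[of "v + t *\<^sub>R x"] Jv by simp
    qed
    \<comment> \<open>The minimizer of the quadratic would divide by (norm x)^2; adding 1 spares a
      separate case x = 0 and still makes the value negative.\<close>
    note ineq = this[of "- d / ((norm x)\<^sup>2 + 1)"]
    have "d = 0"
    proof (rule ccontr)
      assume d: "d \<noteq> 0"
      define D where "D = (norm x)\<^sup>2 + 1"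
      have D: "D > 0" unfolding D_def by (simp add: add_nonneg_pos)
      have "(- d / D)\<^sup>2 * (norm x)\<^sup>2 + 2 * (- d / D) * d = - (d\<^sup>2 / D\<^sup>2) * (D + 1)"
        using D unfolding power_divide power2_eq_square
        by (simp add: divide_simps) (simp add: D_def power2_eq_square algebra_simps)
      moreover have "- (d\<^sup>2 / D\<^sup>2) * (D + 1) < 0"
        using d D by (simp add: mult_neg_pos)
      ultimately show False using ineq unfolding D_def by linarith
    qed
    then show ?thesis unfolding d_def by simp
  qed
  have "f x = cinner v x" for x
    using Re_eq[of x] Re_eq[of "\<i> *\<^sub>C x"] by (simp add: scale cinner_scaleC_right complex_eq_iff)
  then show ?thesis by blast
qed

lemma hadj_exists:
  fixes T :: "'k::chilbert_space \<Rightarrow>\<^sub>L 'l::chilbert_space"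
  assumes T: "T \<in> bounded_ops"
  shows "\<exists>S \<in> bounded_ops. \<forall>x y. cinner (T x) y = cinner x (S y)"
proof -
  have "\<exists>v. \<forall>x. cinner (T x) y = cinner x v" for y
  proof -
    have "\<exists>v. \<forall>x. cinner y (T x) = cinner v x"
    proof (rule riesz_representation[where B = "norm y * norm T"])
      show "cmod (cinner y (T x)) \<le> norm y * norm T * norm x" for x
        using cinner_Cauchy_Schwarz[of y "T x"] norm_blinfun[of T x]
        by (smt (verit) mult.assoc mult_left_mono norm_ge_zero)
    qed (simp_all add: blinfun.add_right cinner_add_right bounded_ops_scaleC[OF T] cinner_scaleC_right)
    then show ?thesis by (metis cinner_commute)
  qed
  then obtain S where S: "\<And>x y. cinner (T x) y = cinner x (S y)" by metis
  have lin: "clinear S"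
    unfolding clinear_def
    by (intro conjI allI cinner_ext)
       (simp_all add: S[symmetric] cinner_add_right cinner_scaleC_right)
  have "norm (S y) \<le> norm y * norm T" for y
  proof -
    have "(norm (S y))\<^sup>2 = cmod (cinner (T (S y)) y)"
      by (simp add: S cinner_norm norm_power)
    also have "\<dots> \<le> norm (S y) * (norm y * norm T)"
      using cinner_Cauchy_Schwarz[of "T (S y)" y] norm_blinfun[of T "S y"]
      by (smt (verit) mult.assoc mult.commute mult_right_mono norm_ge_zero)
    finally show ?thesis
      by (cases "S y = 0") (simp_all add: power2_eq_square)
  qed
  from clinear_Blinfun[OF lin this] show ?thesis using S by (intro bexI[of _ "Blinfun S"]) simp_all
qed

lemma hadj_eq:
  fixes T :: "'k::chilbert_space \<Rightarrow>\<^sub>L 'l::chilbert_space" and S :: "'l \<Rightarrow>\<^sub>L 'k"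
  assumes "\<And>x y. cinner (T x) y = cinner x (S y)"
  shows "hadj T = S"
  unfolding hadj_def
proof (rule the_equality)
  show "\<forall>x y. cinner (T x) y = cinner x (S y)" using assms by simp
  fix S' assume S': "\<forall>x y. cinner (T x) y = cinner x (blinfun_apply S' y)"
  show "S' = S"
    by (intro blinfun_eqI cinner_ext) (metis S' assms)
qed

lemma hadj_bounded_ops: "T \<in> bounded_ops \<Longrightarrow> hadj T \<in> bounded_ops"
  and cinner_hadj: "T \<in> bounded_ops \<Longrightarrow> cinner (T x) y = cinner x (hadj T y)"
  using hadj_exists hadj_eq by metis+

lemma cinner_hadj_left: "T \<in> bounded_ops \<Longrightarrow> cinner (hadj T y) x = cinner y (T x)"
  by (metis cinner_commute cinner_hadj)

lemma hadj_hadj: "T \<in> bounded_ops \<Longrightarrow> hadj (hadj T) = T"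
  by (intro hadj_eq) (rule cinner_hadj_left)

lemma norm_hadj_le: "T \<in> bounded_ops \<Longrightarrow> norm (hadj T) \<le> norm T"
proof (rule norm_blinfun_bound)
  fix y assume T: "T \<in> bounded_ops"
  have "(norm (hadj T y))\<^sup>2 = cmod (cinner (T (hadj T y)) y)"
    by (simp add: cinner_hadj[OF T] cinner_norm norm_power)
  also have "\<dots> \<le> norm (hadj T y) * (norm T * norm y)"
    using cinner_Cauchy_Schwarz[of "T (hadj T y)" y] norm_blinfun[of T "hadj T y"]
    by (smt (verit) mult.assoc mult.commute mult_right_mono norm_ge_zero)
  finally show "norm (hadj T y) \<le> norm T * norm y"
    by (cases "hadj T y = 0") (simp_all add: power2_eq_square)
qed simp

lemma norm_hadj: "T \<in> bounded_ops \<Longrightarrow> norm (hadj T) = norm T"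
  using norm_hadj_le[of T] norm_hadj_le[of "hadj T"] by (simp add: hadj_hadj hadj_bounded_ops)

section \<open>Bounds from power iteration\<close>

text \<open>For b n = a n / K the hypothesis \<open>step\<close> reads (b n)^2 \<le> b (Suc n), so
  (b 0)^(2^n) \<le> (C / K) * L^(2^n) for every n. Taking 2^n-th roots removes C / K in the
  limit.\<close>

lemma power_iteration_bound:
  fixes a :: "nat \<Rightarrow> real"
  assumes nonneg: "\<And>n. 0 \<le> a n" and step: "\<And>n. (a n)\<^sup>2 \<le> K * a (Suc n)"
    and growth: "\<And>n. a n \<le> C * L ^ (2 ^ n)" and "0 \<le> K" "0 \<le> L"
  shows "a 0 \<le> K * L"
proof (cases "K = 0 \<or> L = 0")
  case True
  have "a 0 \<le> 0" using True step[of 0] growth[of 0] by auto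
  then show ?thesis using \<open>0 \<le> K\<close> \<open>0 \<le> L\<close> mult_nonneg_nonneg[of K L] by linarith
next
  case False
  then have K: "K > 0" and L: "L > 0" using assms(4,5) by auto
  have iter: "(a 0 / K) ^ (2 ^ n) \<le> a n / K" for n
  proof (induction n)
    case (Suc n)
    have "(a 0 / K) ^ (2 ^ Suc n) = ((a 0 / K) ^ (2 ^ n))\<^sup>2" by (simp add: power_mult[symmetric] mult.commute)
    also have "\<dots> \<le> (a n / K)\<^sup>2" using Suc nonneg K by (intro power_mono) simp_all
    also have "\<dots> = (a n)\<^sup>2 / K / K" by (simp add: power_divide power2_eq_square)
    also have "\<dots> \<le> a (Suc n) / K"
      using step[of n] K by (intro divide_right_mono) (simp_all add: pos_divide_le_eq mult.commute)
    finally show ?case .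
  qed simp
  define r where "r = a 0 / K / L"
  have r_bound: "r ^ (2 ^ n) \<le> C / K" for n
  proof -
    have "r ^ (2 ^ n) \<le> (a n / K) / L ^ (2 ^ n)"
      unfolding r_def power_divide[of "a 0 / K"] using L by (intro divide_right_mono iter) simp
    also have "\<dots> \<le> C / K"
      using growth[of n] K L by (simp add: field_simps)
    finally show ?thesis .
  qed
  have "r \<le> 1"
  proof (rule ccontr)
    assume "\<not> r \<le> 1"
    then have r: "r > 1" by simp
    then obtain n where n: "C / K < r ^ n" using real_arch_pow by blast
    have "n \<le> 2 ^ n" by (simp add: less_imp_le)
    then have "r ^ n \<le> r ^ (2 ^ n)" using r by (intro power_increasing) simp_all
    then show False using n r_bound[of n] by simp
  qed
  then show ?thesis unfolding r_def using K L by (simp add: field_simps)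
qed

text \<open>Covers both Hilbert spaces, with \<open>c = 1\<close>, and Hilbert modules.  For the latter the constant
  4 comes from polarization, which avoids the positivity arguments behind the sharp
  Cauchy-Schwarz inequality.\<close>

locale semi_inner =
  fixes ip :: "'t::cbanach \<Rightarrow> 't \<Rightarrow> 'b::real_normed_vector" and c :: real
  assumes ip_add_left: "ip (x + y) z = ip x z + ip y z"
    and ip_add_right: "ip x (y + z) = ip x y + ip x z"
    and ip_scaleC: "ip (a *\<^sub>C x) y = ip x (cnj a *\<^sub>C y)"
    and norm_ip: "norm (ip x x) = (norm x)\<^sup>2"
    and ip_bound: "norm (ip x y) \<le> c * norm x * norm y"
    and c_pos: "0 < c"
begin

lemma ip_zero_left [simp]: "ip 0 y = 0"
  using ip_add_left[of 0 0 y] by simp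

lemma ip_zero_right [simp]: "ip y 0 = 0"
  using ip_add_right[of y 0 0] by simp

lemma ip_sum_list_left: "ip (\<Sum>i\<leftarrow>l. g i) y = (\<Sum>i\<leftarrow>l. ip (g i) y)"
  by (induction l) (simp_all add: ip_add_left)

lemma ip_sum_list_right: "ip y (\<Sum>i\<leftarrow>l. g i) = (\<Sum>i\<leftarrow>l. ip y (g i))"
  by (induction l) (simp_all add: ip_add_right)

lemma ip_minus_left: "ip (- x) y = - ip x y"
  using ip_add_left[of x "-x" y] by (simp add: eq_neg_iff_add_eq_0 add.commute)

lemma ip_diff_left: "ip (x - y) z = ip x z - ip y z"
  using ip_add_left[of x "-y" z] by (simp add: ip_minus_left)

lemma ip_minus_right: "ip y (- x) = - ip y x"
  using ip_add_right[of y x "-x"] by (simp add: eq_neg_iff_add_eq_0 add.commute)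

lemma ip_diff_right: "ip z (x - y) = ip z x - ip z y"
  using ip_add_right[of z x "-y"] by (simp add: ip_minus_right)

text \<open>\<open>p\<close> acts on indices because g i \<mapsto> g (p i) is not known to be well
  defined on the span; \<open>G k\<close> is what its k-th power would make of the sum. The square
  root arises from combining (norm (\<Sum>i\<leftarrow>l. f i))^2 \<le> c * norm (G 0) * norm (G 1)
  with norm (G 1) \<le> c * norm (G 0) * L.\<close>

lemma gram_bound:
  fixes ip' :: "'s::cbanach \<Rightarrow> 's \<Rightarrow> 'b" and g :: "'i \<Rightarrow> 't" and f :: "'i \<Rightarrow> 's"
  assumes "semi_inner ip' c'"
    and gram: "\<And>i j. ip' (f i) (f j) = ip (g i) (g (p j))"
    and sym: "\<And>i j. ip (g (p i)) (g j) = ip (g i) (g (p j))"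
    and growth: "\<And>i. \<exists>C. \<forall>n. norm (g ((p ^^ n) i)) \<le> C * L ^ n" and L: "0 \<le> L"
  shows "norm (\<Sum>i\<leftarrow>l. f i) \<le> c * sqrt L * norm (\<Sum>i\<leftarrow>l. g i)"
proof -
  interpret I': semi_inner ip' c' by fact
  define G where "G k = (\<Sum>i\<leftarrow>l. g ((p ^^ k) i))" for k
  have sym_k: "ip (g ((p ^^ k) i)) (g j) = ip (g i) (g ((p ^^ k) j))" for k i j
  proof (induction k arbitrary: j)
    case (Suc k)
    have "ip (g ((p ^^ Suc k) i)) (g j) = ip (g i) (g ((p ^^ k) (p j)))"
      by (simp add: sym Suc)
    then show ?case by (simp only: funpow.simps(2) comp_apply funpow_swap1[of p k j])
  qed simp
  have move: "ip (G k) (G m) = ip (G 0) (G (k + m))" for k m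
    unfolding G_def by (simp add: ip_sum_list_left ip_sum_list_right sym_k funpow_add)
  obtain C where C: "\<And>i n. norm (g ((p ^^ n) i)) \<le> C i * L ^ n" using growth by metis
  \<comment> \<open>The sequence starts at G 1, not at G 0. Symmetry turns \<langle>G m, G
    m\<rangle> into \<langle>G 0, G (2 m)\<rangle>, so only the exponents 2^n occur and K is c *
    norm (G 0).\<close>
  have "norm (G (2 ^ 0)) \<le> (c * norm (G 0)) * L"
  proof (rule power_iteration_bound[where a = "\<lambda>n. norm (G (2 ^ n))" and C = "\<Sum>i\<leftarrow>l. C i"])
    fix n
    have "(norm (G (2 ^ n)))\<^sup>2 = norm (ip (G 0) (G (2 ^ n + 2 ^ n)))"
      by (simp only: norm_ip[symmetric] move[of "2 ^ n" "2 ^ n"])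
    also have "\<dots> \<le> c * norm (G 0) * norm (G (2 ^ Suc n))"
      by (metis ip_bound mult_2 power_Suc)
    finally show "(norm (G (2 ^ n)))\<^sup>2 \<le> c * norm (G 0) * norm (G (2 ^ Suc n))" .
    show "norm (G (2 ^ n)) \<le> (\<Sum>i\<leftarrow>l. C i) * L ^ (2 ^ n)"
      unfolding G_def
    proof (induction l)
      case (Cons i l)
      then show ?case
        using norm_triangle_ineq[of "g ((p ^^ 2 ^ n) i)" "\<Sum>i\<leftarrow>l. g ((p ^^ 2 ^ n) i)"] C[of "2 ^ n" i]
        by (simp add: distrib_right)
    qed simp
  qed (use c_pos L in simp_all)
  then have "norm (G 1) \<le> c * norm (G 0) * L" by simp
  moreover have "(norm (\<Sum>i\<leftarrow>l. f i))\<^sup>2 \<le> c * norm (G 0) * norm (G 1)"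
  proof -
    have "(norm (\<Sum>i\<leftarrow>l. f i))\<^sup>2 = norm (ip (G 0) (G 1))"
      unfolding I'.norm_ip[symmetric] G_def
      by (simp add: ip_sum_list_left ip_sum_list_right I'.ip_sum_list_left I'.ip_sum_list_right gram)
    then show ?thesis using ip_bound[of "G 0" "G 1"] by simp
  qed
  ultimately have "(norm (\<Sum>i\<leftarrow>l. f i))\<^sup>2 \<le> c * norm (G 0) * (c * norm (G 0) * L)"
    using c_pos by (meson mult_left_mono order_trans mult_nonneg_nonneg less_imp_le norm_ge_zero)
  also have "\<dots> = (c * sqrt L * norm (G 0))\<^sup>2"
    using L by (simp add: power_mult_distrib power2_eq_square)
  finally have "norm (\<Sum>i\<leftarrow>l. f i) \<le> c * sqrt L * norm (G 0)"
    by (rule power2_le_imp_le) (use c_pos L in simp)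
  then show ?thesis by (simp add: G_def)
qed

lemma isometric_sum:
  fixes ip' :: "'s::cbanach \<Rightarrow> 's \<Rightarrow> 'b" and g :: "'i \<Rightarrow> 't" and f :: "'i \<Rightarrow> 's"
  assumes "semi_inner ip' c'" and gram: "\<And>i j. ip' (f i) (f j) = ip (g i) (g j)"
  shows "norm (\<Sum>i\<leftarrow>l. f i) = norm (\<Sum>i\<leftarrow>l. g i)"
proof -
  interpret I': semi_inner ip' c' by fact
  have "(norm (\<Sum>i\<leftarrow>l. f i))\<^sup>2 = (norm (\<Sum>i\<leftarrow>l. g i))\<^sup>2"
    unfolding I'.norm_ip[symmetric] norm_ip[symmetric]
    by (simp add: ip_sum_list_left ip_sum_list_right I'.ip_sum_list_left I'.ip_sum_list_right gram)
  then show ?thesis by simp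
qed

end

section \<open>Hilbert spaces and Hilbert modules as instances\<close>

lemma semi_inner_cinner: "semi_inner (cinner :: 'k::chilbert_space \<Rightarrow> 'k \<Rightarrow> complex) 1"
  by unfold_locales
     (simp_all add: cinner_add_left cinner_add_right cinner_scaleC_left cinner_scaleC_right
        cinner_norm norm_power cinner_Cauchy_Schwarz)

lemma norm_star [simp]: "norm (star a) = norm (a::'a::cstar_algebra)"
proof -
  have le: "norm b \<le> norm (star b)" for b :: 'a
  proof (cases "b = 0")
    case False
    have "norm b * norm b \<le> norm (star b) * norm b"
      using norm_mult_ineq[of "star b" b] by (simp add: cstar_identity power2_eq_square)
    then show ?thesis using False by simp
  qed simp
  show ?thesis using le[of a] le[of "star a"] by (simp add: star_star)
qed

lemma hilbert_moduleD:
  assumes "hilbert_module ract ip"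
  shows "cbilinear ract" "ract x (a * b) = ract (ract x a) b"
    "ip x (y + z) = ip x y + ip x z" "ip x (c *\<^sub>C y) = c *\<^sub>C ip x y"
    "ip x (ract y a) = ip x y * a" "ip y x = star (ip x y)" "(norm x)\<^sup>2 = norm (ip x x)"
  using assms unfolding hilbert_module_def clinear_def by blast+

lemma semi_inner_module:
  assumes H: "hilbert_module ract (ip :: 'y::cbanach \<Rightarrow> 'y \<Rightarrow> 'a::cstar_algebra)"
  shows "semi_inner ip 4"
proof
  note D = hilbert_moduleD[OF H]
  show add_left: "ip (x + y) z = ip x z + ip y z" for x y z
    by (metis D(3,6) star_add)
  have scale_left: "ip (a *\<^sub>C x) y = cnj a *\<^sub>C ip x y" for a x y
    by (metis D(4,6) star_scaleC)
  show "ip (a *\<^sub>C x) y = ip x (cnj a *\<^sub>C y)" for a x y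
    by (simp add: scale_left D(4))
  show "norm (ip x x) = (norm x)\<^sup>2" for x by (simp add: D(7))
  have zero: "ip 0 x = 0" "ip x 0 = 0" for x
    using scale_left[of 0 0 x] D(4)[of x 0 0] by simp_all
  have scale: "ip (of_real r *\<^sub>C x) y = of_real r *\<^sub>C ip x y" for r x y
    by (simp add: scale_left)
  have minus_left: "ip (- x) y = - ip x y" for x y
    using scale_left[of "-1" x y] by (simp add: scaleC_minus_one)
  have minus_right: "ip x (- y) = - ip x y" for x y
    using D(4)[of x "-1" y] by (simp add: scaleC_minus_one)
  have diff_left: "ip (x - y) z = ip x z - ip y z" for x y z
    using add_left[of x "-y" z] by (simp add: minus_left)
  have diff_right: "ip z (x - y) = ip z x - ip z y" for x y z
    using D(3)[of z x "-y"] by (simp add: minus_right)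
  \<comment> \<open>Each of the four values of \<open>q\<close> in the polarization identity has
    norm at most 2^2; their sum 16 is divided by 4.\<close>
  have unit: "norm (ip x y) \<le> 4" if "norm x = 1" "norm y = 1" for x y
  proof -
    define q where "q z = ip (x + z) (x + z)" for z
    have polar: "q y - q (- y) - \<i> *\<^sub>C (q (\<i> *\<^sub>C y) - q (- (\<i> *\<^sub>C y))) = 4 *\<^sub>R ip x y"
    proof -
      have "q y - q (- y) = 2 *\<^sub>R ip x y + 2 *\<^sub>R ip y x"
        unfolding q_def by (simp add: add_left D(3) diff_left diff_right scaleR_2)
      moreover have "q (\<i> *\<^sub>C y) - q (- (\<i> *\<^sub>C y)) = 2 *\<^sub>R (\<i> *\<^sub>C ip x y) - 2 *\<^sub>R (\<i> *\<^sub>C ip y x)"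
        unfolding q_def
        by (simp add: add_left D(3,4) diff_left diff_right scaleR_2 scale_left scaleC_minus_left
            scaleC_diff_right scaleC_add_right)
      ultimately show ?thesis
        using scaleR_left_distrib[of 2 2 "ip x y"]
        by (simp add: scaleR_2 scaleC_diff_right scaleC_add_right scaleC_scaleC scaleC_minus_left)
    qed
    have q_le: "norm (q z) \<le> 4" if "norm z = 1" for z
    proof -
      have "norm (x + z) \<le> 2" using norm_triangle_ineq[of x z] that \<open>norm x = 1\<close> by simp
      then have "(norm (x + z))\<^sup>2 \<le> 2\<^sup>2" by (intro power_mono) simp_all
      then show ?thesis by (simp add: q_def D(7)[symmetric])
    qed
    have "norm (4 *\<^sub>R ip x y) \<le> norm (q y) + norm (q (- y))
      + (norm (q (\<i> *\<^sub>C y)) + norm (q (- (\<i> *\<^sub>C y))))"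
      unfolding polar[symmetric]
      using norm_triangle_ineq4[of "q y - q (- y)" "\<i> *\<^sub>C (q (\<i> *\<^sub>C y) - q (- (\<i> *\<^sub>C y)))"]
        norm_triangle_ineq4[of "q y" "q (- y)"]
        norm_triangle_ineq4[of "q (\<i> *\<^sub>C y)" "q (- (\<i> *\<^sub>C y))"]
      by (simp add: norm_scaleC)
    also have "\<dots> \<le> 4 + 4 + (4 + 4)"
      using that by (intro add_mono q_le) (simp_all add: norm_scaleC)
    finally show ?thesis by simp
  qed
  show "norm (ip x y) \<le> 4 * norm x * norm y" for x y
  proof (cases "x = 0 \<or> y = 0")
    case False
    have "norm (ip (of_real (1 / norm x) *\<^sub>C x) (of_real (1 / norm y) *\<^sub>C y)) \<le> 4"
      using False by (intro unit) (simp_all add: norm_scaleC norm_divide)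
    also have "ip (of_real (1 / norm x) *\<^sub>C x) (of_real (1 / norm y) *\<^sub>C y)
      = of_real (1 / norm x * (1 / norm y)) *\<^sub>C ip x y"
      by (simp only: scale D(4) scaleC_scaleC of_real_mult mult.commute)
    finally show ?thesis using False by (simp add: norm_scaleC norm_mult norm_divide field_simps)
  qed (auto simp: zero)
qed (simp_all add: hilbert_moduleD(3)[OF H])

lemma norm_ract_le:
  assumes H: "hilbert_module ract ip"
  shows "norm (ract x a) \<le> norm x * norm a"
proof -
  note D = hilbert_moduleD[OF H]
  have "ip (ract x a) (ract x a) = star a * ip x x * a"
    by (metis D(5,6) star_mult star_star)
  then have "(norm (ract x a))\<^sup>2 \<le> norm (star a * ip x x) * norm a"
    by (simp add: D(7) norm_mult_ineq)
  also have "\<dots> \<le> norm a * norm (ip x x) * norm a"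
    using norm_mult_ineq[of "star a" "ip x x"] by (intro mult_right_mono) simp_all
  also have "\<dots> = (norm x * norm a)\<^sup>2"
    by (simp add: D(7)[symmetric] power_mult_distrib power2_eq_square)
  finally show ?thesis by (rule power2_le_imp_le) simp
qed

section \<open>Automatic continuity of \<open>*\<close>-homomorphisms\<close>

text \<open>\<open>1 - s\<close> is a square root of \<open>1 - a\<^sup>2\<close>, obtained as a fixed point.\<close>

lemma sqrt_complement_exists:
  fixes a :: "'a::cstar_algebra"
  assumes a: "norm a < 1" and sa: "star a = a"
  shows "\<exists>s. s + s - s * s = a * a \<and> star s = s \<and> a * s = s * a"
proof -
  define r where "r = norm a"
  have r: "0 \<le> r" "r < 1" using a by (simp_all add: r_def)
  \<comment> \<open>Commutation with a is built into the domain, so the fixed point inherits it.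
    Self-adjointness comes afterwards from the contraction estimate, since \<open>star s\<close> is
    a fixed point in the same ball.\<close>
  define S where "S = {s. norm s \<le> r \<and> a * s = s * a}"
  \<comment> \<open>The equation 2 s = a^2 + s^2 is (1 - s)^2 = 1 - a^2 multiplied out, which makes
    sense without a unit.\<close>
  define F where "F s = (1/2) *\<^sub>R (a * a + s * s)" for s
  have sq_le: "norm (s * s) \<le> r" if "norm s \<le> r" for s :: 'a
  proof -
    have "norm (s * s) \<le> norm s * norm s" by (rule norm_mult_ineq)
    also have "\<dots> \<le> r * 1" using that r by (intro mult_mono) simp_all
    finally show ?thesis by simp
  qed
  have F_ball: "norm (F s) \<le> r" if "norm s \<le> r" for s
    unfolding F_def using norm_triangle_ineq[of "a * a" "s * s"] sq_le[OF that] sq_le[of a]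
    by (simp add: r_def)
  have contract: "norm (F s - F t) \<le> r * norm (s - t)" if "norm s \<le> r" "norm t \<le> r" for s t
  proof -
    have "F s - F t = (1/2) *\<^sub>R (s * (s - t) + (s - t) * t)"
      unfolding F_def by (simp add: algebra_simps)
    moreover have "norm (s * (s - t)) \<le> r * norm (s - t)"
      using norm_mult_ineq[of s "s - t"] that by (meson mult_right_mono norm_ge_zero order_trans)
    moreover have "norm ((s - t) * t) \<le> r * norm (s - t)"
      using norm_mult_ineq[of "s - t" t] that
      by (metis mult.commute mult_right_mono norm_ge_zero order_trans)
    ultimately show ?thesis
      using norm_triangle_ineq[of "s * (s - t)" "(s - t) * t"] by simp
  qed
  have "\<exists>!s\<in>S. F s = s"
  proof (rule Banach_fix)
    have "S = cball 0 r \<inter> {s. a * s = s * a}" unfolding S_def by auto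
    moreover have "closed {s. a * s = s * a}"
      by (intro closed_Collect_eq continuous_intros)
    ultimately show "complete S" by (simp add: closed_Int complete_eq_closed)
    show "S \<noteq> {}" unfolding S_def using r by (auto intro: exI[of _ 0])
    show "F ` S \<subseteq> S"
    proof clarify
      fix s assume s: "s \<in> S"
      then have as: "a * s = s * a" unfolding S_def by blast
      have "a * (s * s) = s * s * a" by (simp only: mult.assoc[symmetric] as) (simp only: mult.assoc as)
      then have "a * F s = F s * a" unfolding F_def by (simp add: distrib_left distrib_right mult.assoc)
      then show "F s \<in> S" using s F_ball unfolding S_def by blast
    qed
    show "dist (F s) (F t) \<le> r * dist s t" if "s \<in> S" "t \<in> S" for s t
      using contract that unfolding S_def dist_norm by blast
  qed (use r in simp_all)
  then obtain s where s: "norm s \<le> r" "a * s = s * a" "F s = s" unfolding S_def by blast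
  have star_F: "F (star s) = star (F s)"
    unfolding F_def by (simp add: scaleR_scaleC star_scaleC star_add star_mult sa)
  have "norm (star s - s) \<le> r * norm (star s - s)"
    using contract[of "star s" s] s star_F by simp
  then have "(1 - r) * norm (star s - s) \<le> 0" by (simp add: algebra_simps)
  then have "star s = s" using r by (simp add: mult_le_0_iff)
  moreover have "s + s - s * s = a * a"
  proof -
    have "s + s = 2 *\<^sub>R F s" by (simp only: s(3) scaleR_2)
    then show ?thesis unfolding F_def by simp
  qed
  ultimately show ?thesis using s(2) by blast
qed

text \<open>A self-adjoint \<open>a\<close> with \<open>norm a < 1\<close> is the real part of the unitary
  \<open>a + \<i> sqrt (1 - a\<^sup>2)\<close>, which acts isometrically.\<close>

lemma (in semi_inner) star_action_bounded:
  fixes \<phi> :: "'a::cstar_algebra \<Rightarrow> 't \<Rightarrow> 't"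
  assumes lin: "\<And>a. clinear (\<phi> a)"
    and add: "\<And>a b x. \<phi> (a + b) x = \<phi> a x + \<phi> b x"
    and scale: "\<And>k a x. \<phi> (k *\<^sub>C a) x = k *\<^sub>C \<phi> a x"
    and mult: "\<And>a b x. \<phi> (a * b) x = \<phi> a (\<phi> b x)"
    and adj: "\<And>a x y. ip (\<phi> a x) y = ip x (\<phi> (star a) y)"
  shows "norm (\<phi> a x) \<le> 2 * norm a * norm x"
proof -
  note lin_add = clinear_add[OF lin] and lin_scale = clinear_scaleC[OF lin]
  have lin_diff: "\<phi> a (x - y) = \<phi> a x - \<phi> a y" for a x y
    using linear_diff[OF clinear_linear[OF lin]] .
  have diff: "\<phi> (a - b) x = \<phi> a x - \<phi> b x" for a b x
    using add[of "a - b" b x] by simp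
  have small: "norm (\<phi> a x) \<le> norm x" if a: "norm a < 1" and sa: "star a = a" for a x
  proof -
    obtain s where s: "s + s - s * s = a * a" "star s = s" "a * s = s * a"
      using sqrt_complement_exists[OF a sa] by blast
    \<comment> \<open>\<open>D\<close> stands for the action of 1 - s and is defined on the space
      itself, since the algebra may lack a unit.\<close>
    define D where "D x = x - \<phi> s x" for x
    have DD: "D (D x) = x - \<phi> (a * a) x" for x
      unfolding D_def s(1)[symmetric] by (simp add: lin_diff diff add mult)
    have AD: "\<phi> a (D x) = D (\<phi> a x)" for x
      unfolding D_def by (simp add: lin_diff s(3) mult[symmetric])
    have D_adj: "ip (D x) y = ip x (D y)" for x y
      unfolding D_def by (simp add: ip_diff_left ip_diff_right adj s(2))
    have A_adj: "ip (\<phi> a x) y = ip x (\<phi> a y)" for x y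
      by (simp add: adj sa)
    have D_scale: "D (k *\<^sub>C x) = k *\<^sub>C D x" for k x
      unfolding D_def by (simp add: lin_scale scaleC_diff_right)
    \<comment> \<open>The cross terms cancel because \<open>D\<close> commutes with
      \<open>\<phi> a\<close>, and the squares of the two add up to the identity. The mean of the
      two isometries is \<open>\<phi> a\<close>.\<close>
    have unitary: "norm (\<phi> a x + k *\<^sub>C D x) = norm x" if k: "k = \<i> \<or> k = - \<i>" for k x
    proof -
      have kk: "cnj k = - k" "k * k = - 1" using k by auto
      have "ip (\<phi> a x + k *\<^sub>C D x) (\<phi> a x + k *\<^sub>C D x)
        = ip x (\<phi> a (\<phi> a x)) + ip x (\<phi> a (k *\<^sub>C D x)) + ip x (D (cnj k *\<^sub>C \<phi> a x))
          + ip x (D (cnj k *\<^sub>C k *\<^sub>C D x))"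
        by (simp add: ip_add_left ip_add_right ip_scaleC A_adj D_adj)
      also have "\<phi> a (k *\<^sub>C D x) = k *\<^sub>C D (\<phi> a x)" by (simp add: lin_scale AD)
      also have "D (cnj k *\<^sub>C \<phi> a x) = - (k *\<^sub>C D (\<phi> a x))" unfolding D_scale by (simp add: kk scaleC_minus_left)
      also have "D (cnj k *\<^sub>C k *\<^sub>C D x) = x - \<phi> a (\<phi> a x)"
        by (simp add: scaleC_scaleC kk DD mult)
      finally have "ip (\<phi> a x + k *\<^sub>C D x) (\<phi> a x + k *\<^sub>C D x) = ip x x"
        by (simp add: ip_minus_right ip_diff_right)
      then have "(norm (\<phi> a x + k *\<^sub>C D x))\<^sup>2 = (norm x)\<^sup>2" by (metis norm_ip)
      then show ?thesis by simp
    qed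
    have "2 *\<^sub>R \<phi> a x = (\<phi> a x + \<i> *\<^sub>C D x) + (\<phi> a x + (- \<i>) *\<^sub>C D x)"
      by (simp add: scaleC_minus_left scaleR_2)
    then have "2 * norm (\<phi> a x) \<le> norm (\<phi> a x + \<i> *\<^sub>C D x) + norm (\<phi> a x + (- \<i>) *\<^sub>C D x)"
      by (metis norm_triangle_ineq norm_scaleR abs_numeral)
    then show ?thesis using unitary by simp
  qed
  have selfadj: "norm (\<phi> a x) \<le> norm a * norm x" if sa: "star a = a" for a x
  proof (rule field_le_epsilon)
    fix e :: real assume e: "e > 0"
    \<comment> \<open>The element a / d has norm strictly below 1, as the square root requires; the
      denominator norm x + 1 keeps the excess at most e, also for x = 0.\<close>
    define d where "d = norm a + e / (norm x + 1)"
    have pos: "e / (norm x + 1) > 0" using e by (simp add: add_nonneg_pos)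
    have d: "norm a < d" "d > 0" unfolding d_def using pos by (simp, smt (verit) norm_ge_zero)
    have "norm (\<phi> (of_real (1 / d) *\<^sub>C a) x) \<le> norm x"
      using d by (intro small) (simp_all add: norm_scaleC star_scaleC sa norm_divide)
    then have "norm (\<phi> a x) \<le> d * norm x"
      using d by (simp add: scale norm_scaleC norm_divide field_simps)
    also have "\<dots> \<le> norm a * norm x + e"
    proof -
      have "e * norm x \<le> e * (norm x + 1)" using e by simp
      then have "e / (norm x + 1) * norm x \<le> e"
        by (simp add: divide_le_eq add_nonneg_pos)
      then show ?thesis unfolding d_def by (simp add: distrib_right)
    qed
    finally show "norm (\<phi> a x) \<le> norm a * norm x + e" .
  qed
  \<comment> \<open>\<open>b\<close> and \<open>d\<close> are twice the real part and minus twice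
    the imaginary part of a; estimating them separately costs the factor 2.\<close>
  define b where "b = a + star a"
  define d where "d = \<i> *\<^sub>C (a - star a)"
  have b: "star b = b" by (simp add: b_def star_add star_star add.commute)
  have star_minus: "star (- y) = - star y" for y :: 'a
    using star_scaleC[of "-1" y] by (simp add: scaleC_minus_one)
  have "star (a - star a) = - (a - star a)"
    using star_add[of a "- star a"] by (simp add: star_minus star_star)
  then have d: "star d = d"
    unfolding d_def star_scaleC by (simp add: scaleC_minus_left scaleC_diff_right)
  have nb: "norm b \<le> 2 * norm a" using norm_triangle_ineq[of a "star a"] by (simp add: b_def)
  have nd: "norm d \<le> 2 * norm a"
    using norm_triangle_ineq4[of a "star a"] by (simp add: d_def norm_scaleC)
  have "a + a = b + (- \<i>) *\<^sub>C d"
    by (simp add: b_def d_def scaleC_scaleC)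
  then have "\<phi> a x + \<phi> a x = \<phi> b x + (- \<i>) *\<^sub>C \<phi> d x" by (metis add scale)
  then have "norm (2 *\<^sub>R \<phi> a x) \<le> norm (\<phi> b x) + norm (\<phi> d x)"
    using norm_triangle_ineq[of "\<phi> b x" "(- \<i>) *\<^sub>C \<phi> d x"] by (simp only: scaleR_2 norm_scaleC) simp
  then have "2 * norm (\<phi> a x) \<le> norm (\<phi> b x) + norm (\<phi> d x)" by simp
  also have "\<dots> \<le> 2 * norm a * norm x + 2 * norm a * norm x"
    using selfadj[OF b, of x] selfadj[OF d, of x] mult_right_mono[OF nb, of "norm x"]
      mult_right_mono[OF nd, of "norm x"] by simp
  finally show ?thesis by simp
qed

section \<open>Operators on tensor products\<close>

lemma star_representationD:
  assumes "star_representation \<pi>"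
  shows "\<pi> a \<in> bounded_ops" "\<pi> (a + b) = \<pi> a + \<pi> b" "\<pi> (c *\<^sub>C a) k = c *\<^sub>C \<pi> a k"
    "\<pi> (a * b) k = \<pi> a (\<pi> b k)" "cinner (\<pi> a x) y = cinner x (\<pi> (star a) y)"
  using assms unfolding star_representation_def by simp_all

lemma correspondenceD:
  assumes "correspondence \<phi> ract ip"
  shows "hilbert_module ract ip" "\<phi> a \<in> bounded_ops" "\<phi> a (ract x b) = ract (\<phi> a x) b"
    "\<phi> (a + a') = \<phi> a + \<phi> a'" "\<phi> (c *\<^sub>C a) x = c *\<^sub>C \<phi> a x"
    "\<phi> (a * a') x = \<phi> a (\<phi> a' x)" "ip (\<phi> a x) y = ip x (\<phi> (star a) y)"
  using assms unfolding correspondence_def adjointable_ops_def by simp_all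

lemma norm_star_representation_le:
  assumes "star_representation \<pi>"
  shows "norm (\<pi> a x) \<le> 2 * norm a * norm x"
  by (rule semi_inner.star_action_bounded[OF semi_inner_cinner])
     (use star_representationD[OF assms] in \<open>simp_all add: bounded_ops_def blinfun.add_left\<close>)

lemma norm_left_action_le:
  assumes "correspondence \<phi> ract ip"
  shows "norm (\<phi> a x) \<le> 2 * norm a * norm x"
  by (rule semi_inner.star_action_bounded[OF semi_inner_module[OF correspondenceD(1)[OF assms]]])
     (use correspondenceD[OF assms] in \<open>simp_all add: bounded_ops_def blinfun.add_left\<close>)

lemma hilbert_tensorD:
  assumes "hilbert_tensor ip \<pi> t"
  shows "cbilinear t" "cinner (t \<xi> h) (t \<eta> k) = cinner h (\<pi> (ip \<xi> \<eta>) k)"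
    "closure (span {t \<xi> h |\<xi> h. True}) = UNIV"
  using assms unfolding hilbert_tensor_def by simp_all

lemma module_tensorD:
  assumes "module_tensor ipY \<phi> ractZ ipZ t ractT ipT"
  shows "hilbert_module ractT ipT" "cbilinear t"
    "ipT (t y z) (t y' z') = ipZ z (\<phi> (ipY y y') z')" "ractT (t y z) b = t y (ractZ z b)"
    "closure (span {t y z |y z. True}) = UNIV"
  using assms unfolding module_tensor_def by simp_all

text \<open>The factor is the square root of the 2 in \<open>norm_star_representation_le\<close>,
  rounded up. Its size is irrelevant later: the bound only feeds the growth condition of the
  iteration.\<close>

lemma norm_hilbert_tensor_le:
  assumes H: "hilbert_module ract ip" and \<pi>: "star_representation \<pi>" and t: "hilbert_tensor ip \<pi> t"
  shows "norm (t y k) \<le> 2 * norm y * norm k"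
proof -
  have "(norm (t y k))\<^sup>2 = cmod (cinner k (\<pi> (ip y y) k))"
    by (simp add: hilbert_tensorD(2)[OF t, symmetric] cinner_norm norm_power)
  also have "\<dots> \<le> norm k * norm (\<pi> (ip y y) k)" by (rule cinner_Cauchy_Schwarz)
  also have "\<dots> \<le> norm k * (2 * norm (ip y y) * norm k)"
    by (intro mult_left_mono norm_star_representation_le[OF \<pi>]) simp
  also have "\<dots> \<le> (2 * norm y * norm k)\<^sup>2"
    by (simp add: hilbert_moduleD(7)[OF H, symmetric] power2_eq_square)
  finally show ?thesis by (rule power2_le_imp_le) simp
qed

text \<open>Under the square stand 4 from the module Cauchy-Schwarz bound and 2 from the bound on
  left actions; 3 is the square root of 8 rounded up.\<close>

lemma norm_module_tensor_le:
  assumes H: "hilbert_module ractY ipY" and Z: "correspondence \<phi> ractZ ipZ"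
    and t: "module_tensor ipY \<phi> ractZ ipZ t ractT ipT"
  shows "norm (t y z) \<le> 3 * norm y * norm z"
proof -
  interpret Z: semi_inner ipZ 4 by (rule semi_inner_module[OF correspondenceD(1)[OF Z]])
  have "(norm (t y z))\<^sup>2 = norm (ipZ z (\<phi> (ipY y y) z))"
    by (simp add: hilbert_moduleD(7)[OF module_tensorD(1)[OF t]] module_tensorD(3)[OF t])
  also have "\<dots> \<le> 4 * norm z * norm (\<phi> (ipY y y) z)" by (rule Z.ip_bound)
  also have "\<dots> \<le> 4 * norm z * (2 * norm (ipY y y) * norm z)"
    by (intro mult_left_mono norm_left_action_le[OF Z]) simp
  also have "\<dots> \<le> (3 * norm y * norm z)\<^sup>2"
    by (simp add: hilbert_moduleD(7)[OF H, symmetric] power2_eq_square)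
  finally show ?thesis by (rule power2_le_imp_le) simp
qed

lemma tensor_range: "range (case_prod t) = {t y k |y k. True}"
  by auto

lemma tensor_op_eq:
  fixes T :: "'t::cbanach \<Rightarrow>\<^sub>L 's::cbanach" and S :: "'y::cbanach \<Rightarrow>\<^sub>L 'y2::cbanach"
    and R :: "'k::cbanach \<Rightarrow>\<^sub>L 'k2::cbanach"
  assumes dense: "closure (span {t y k |y k. True}) = UNIV" and T: "T \<in> bounded_ops"
    and gen: "\<And>y k. T (t y k) = t' (S y) (R k)"
  shows "tensor_op t t' S R = T"
  unfolding tensor_op_def
proof (rule the_equality)
  show "T \<in> bounded_ops \<and> (\<forall>y k. T (t y k) = t' (S y) (R k))" using T gen by simp
  fix T' :: "'t \<Rightarrow>\<^sub>L 's"
  assume "T' \<in> bounded_ops \<and> (\<forall>y k. T' (t y k) = t' (S y) (R k))"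
  then show "T' = T" by (intro blinfun_eq_on_dense[OF dense]) (auto simp: gen)
qed

context semi_inner
begin

text \<open>P and Q play the parts of S* S and R* R, known only through their effect on Gram
  kernels. On each elementary tensor their iterates grow at most like the powers of norm P * norm Q,
  which is where the norm bound comes from.\<close>

lemma tensor_op_exists:
  fixes ip' :: "'s::cbanach \<Rightarrow> 's \<Rightarrow> 'b" and S :: "'y::cbanach \<Rightarrow>\<^sub>L 'y2::cbanach"
    and R :: "'k::cbanach \<Rightarrow>\<^sub>L 'k2::cbanach" and P :: "'y \<Rightarrow>\<^sub>L 'y" and Q :: "'k \<Rightarrow>\<^sub>L 'k"
  assumes ip': "semi_inner ip' c'" and t: "cbilinear t" and t': "cbilinear t'"
    and dense: "closure (span {t y k |y k. True}) = UNIV"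
    and t_bound: "\<And>y k. norm (t y k) \<le> B * norm y * norm k" and B: "0 \<le> B"
    and S: "S \<in> bounded_ops"
    and gram: "\<And>y k y' k'. ip' (t' (S y) (R k)) (t' (S y') (R k')) = ip (t y k) (t (P y') (Q k'))"
    and sym: "\<And>y k y' k'. ip (t (P y) (Q k)) (t y' k') = ip (t y k) (t (P y') (Q k'))"
  shows "tensor_op t t' S R \<in> bounded_ops"
    and "tensor_op t t' S R (t y k) = t' (S y) (R k)"
    and "norm (tensor_op t t' S R) \<le> c * sqrt (norm P * norm Q)"
proof -
  define L where "L = norm P * norm Q"
  have "\<exists>T::'t \<Rightarrow>\<^sub>L 's. T \<in> bounded_ops \<and> (\<forall>i. T (case_prod t i) = t' (S (fst i)) (R (snd i))) \<and> norm T \<le> c * sqrt L"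
  proof (rule bounded_extension)
    show "closure (span (range (case_prod t))) = UNIV" unfolding tensor_range by (rule dense)
    show "\<exists>j. case_prod t j = a *\<^sub>C case_prod t i \<and>
        t' (S (fst j)) (R (snd j)) = a *\<^sub>C t' (S (fst i)) (R (snd i))" for a i
      by (rule exI[of _ "(a *\<^sub>C fst i, snd i)"])
         (simp add: case_prod_beta cbilinear_scaleC_left[OF t] cbilinear_scaleC_left[OF t']
           bounded_ops_scaleC[OF S])
    show "norm (\<Sum>i\<leftarrow>l. t' (S (fst i)) (R (snd i))) \<le> c * sqrt L * norm (\<Sum>i\<leftarrow>l. case_prod t i)" for l
    proof (rule gram_bound[OF ip', where p = "map_prod P Q"])
      fix i :: "'y \<times> 'k"
      show "\<exists>C. \<forall>n. norm (case_prod t ((map_prod P Q ^^ n) i)) \<le> C * L ^ n"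
      proof (intro exI allI)
        fix n
        have iter: "(map_prod P Q ^^ n) i = ((blinfun_apply P ^^ n) (fst i), (blinfun_apply Q ^^ n) (snd i))"
          by (induction n) simp_all
        have "norm (t ((blinfun_apply P ^^ n) (fst i)) ((blinfun_apply Q ^^ n) (snd i)))
          \<le> B * norm ((blinfun_apply P ^^ n) (fst i)) * norm ((blinfun_apply Q ^^ n) (snd i))" by (rule t_bound)
        also have "\<dots> \<le> B * (norm P ^ n * norm (fst i)) * (norm Q ^ n * norm (snd i))"
          using B by (intro mult_mono mult_left_mono norm_blinfun_funpow) simp_all
        finally show "norm (case_prod t ((map_prod P Q ^^ n) i))
          \<le> (B * norm (fst i) * norm (snd i)) * L ^ n"
          unfolding iter L_def by (simp add: power_mult_distrib mult_ac)
      qed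
    qed (simp_all add: case_prod_beta gram sym L_def)
  qed (use c_pos L_def in simp)
  then obtain T where T: "T \<in> bounded_ops" "\<And>y k. T (t y k) = t' (S y) (R k)"
    "norm T \<le> c * sqrt L" by auto
  then have "tensor_op t t' S R = T" by (intro tensor_op_eq[OF dense])
  then show "tensor_op t t' S R \<in> bounded_ops" "tensor_op t t' S R (t y k) = t' (S y) (R k)"
    "norm (tensor_op t t' S R) \<le> c * sqrt (norm P * norm Q)"
    using T by (simp_all add: L_def)
qed

lemma induced_exists:
  fixes \<phi> :: "'a::cstar_algebra \<Rightarrow> ('y::cbanach \<Rightarrow>\<^sub>L 'y)"
  assumes t: "cbilinear t" and dense: "closure (span {t y k |y k. True}) = UNIV"
    and t_bound: "\<And>y k. norm (t y k) \<le> B * norm y * norm k" and B: "0 \<le> B"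
    and \<phi>: "\<And>a. \<phi> a \<in> bounded_ops" and mult: "\<And>a b y. \<phi> (a * b) y = \<phi> a (\<phi> b y)"
    and adj: "\<And>a y k y' k'. ip (t (\<phi> a y) k) (t y' k') = ip (t y k) (t (\<phi> (star a) y') k')"
  shows "induced t \<phi> a \<in> bounded_ops" and "induced t \<phi> a (t y k) = t (\<phi> a y) k"
  \<comment> \<open>The squared modulus of \<open>\<phi> a\<close> is supplied by the algebra
    itself, as \<open>\<phi> (star a * a)\<close>.\<close>
  using tensor_op_exists[OF semi_inner_axioms t t dense t_bound B \<phi>,
      of a id_blinfun "\<phi> (star a * a)" id_blinfun]
  by (simp_all add: induced_def adj mult star_mult star_star)

end

section \<open>Testing identities on dense spans\<close>

lemma bounded_linear_cinner_right: "bounded_linear (\<lambda>y. cinner x (y::'k::chilbert_space))"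
  by (rule bounded_linear_intro[where K = "norm x"])
     (use cinner_Cauchy_Schwarz[of x] in \<open>simp_all add: cinner_add_right cinner_scaleR_right
       scaleR_conv_of_real mult.commute\<close>)

lemma bounded_linear_cinner_left: "bounded_linear (\<lambda>x. cinner x (y::'k::chilbert_space))"
  by (rule bounded_linear_intro[where K = "norm y"])
     (simp_all add: cinner_add_left cinner_scaleR_left scaleR_conv_of_real cinner_Cauchy_Schwarz)

lemma bounded_linear_eq_on_dense:
  assumes "closure (span A) = UNIV" and "bounded_linear f" "bounded_linear g"
    and "\<And>x. x \<in> A \<Longrightarrow> f x = g x"
  shows "f x = g x"
proof -
  have "f x - g x \<in> closure (span {0})"
    by (rule closure_span_image[OF bounded_linear_sub[OF assms(2,3)], where A = A])
       (use assms in simp_all)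
  then show ?thesis by simp
qed

lemma cinner_ext_dense:
  assumes "closure (span A) = UNIV" and "\<And>x. x \<in> A \<Longrightarrow> cinner x y = cinner x z"
  shows "y = (z::'k::chilbert_space)"
  by (rule cinner_ext, rule bounded_linear_eq_on_dense[OF assms(1)])
     (use assms(2) bounded_linear_cinner_left in auto)

lemma adjoint_on_dense:
  fixes S :: "'k::chilbert_space \<Rightarrow>\<^sub>L 'l::chilbert_space" and T :: "'l \<Rightarrow>\<^sub>L 'k"
  assumes A: "closure (span A) = UNIV" and B: "closure (span B) = UNIV"
    and gen: "\<And>x y. x \<in> A \<Longrightarrow> y \<in> B \<Longrightarrow> cinner (S x) y = cinner x (T y)"
  shows "cinner (S x) y = cinner x (T y)"
proof -
  note right = bounded_linear_cinner_right and left = bounded_linear_cinner_left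
  have T: "bounded_linear (\<lambda>y. cinner x (T y))" for x
    by (rule bounded_linear_compose[OF right blinfun.bounded_linear_right])
  have S: "bounded_linear (\<lambda>x. cinner (S x) y)"
    by (rule bounded_linear_compose[OF left blinfun.bounded_linear_right])
  have "cinner (S x) y = cinner x (T y)" if x: "x \<in> A" for x
    using bounded_linear_eq_on_dense[OF B right[of "S x"] T[of x] gen[OF x]] .
  from bounded_linear_eq_on_dense[OF A S left[of "T y"] this] show ?thesis .
qed

text \<open>That the induced action is again a representation permits iterated tensor products: it
  defines the inner products of X \<otimes> (F \<otimes> H) and E \<otimes> (X \<otimes> H).\<close>

lemma hilbert_induced:
  fixes t :: "'y::cbanach \<Rightarrow> 'k::chilbert_space \<Rightarrow> 't::chilbert_space"
  assumes \<phi>: "correspondence \<phi> ract ip" and \<pi>: "star_representation \<pi>" and t: "hilbert_tensor ip \<pi> t"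
  shows "induced t \<phi> a \<in> bounded_ops" and "induced t \<phi> a (t y k) = t (\<phi> a y) k"
    and "star_representation (induced t \<phi>)"
proof -
  note D = correspondenceD[OF \<phi>] and tD = hilbert_tensorD[OF t]
  interpret semi_inner "cinner :: 't \<Rightarrow> 't \<Rightarrow> complex" 1 by (rule semi_inner_cinner)
  have *: "induced t \<phi> a \<in> bounded_ops" "induced t \<phi> a (t y k) = t (\<phi> a y) k" for a y k
    by (rule induced_exists[OF tD(1,3) norm_hilbert_tensor_le[OF D(1) \<pi> t] _ D(2,6)];
        simp add: tD(2) D(7))+
  show "induced t \<phi> a \<in> bounded_ops" "induced t \<phi> a (t y k) = t (\<phi> a y) k" by (fact *)+
  have add: "induced t \<phi> (a + b) = induced t \<phi> a + induced t \<phi> b" for a b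
    by (rule blinfun_eq_on_dense[OF tD(3)])
       (auto simp: * blinfun.add_left D(4) cbilinear_add_left[OF tD(1)])
  have mult: "induced t \<phi> (a * b) = induced t \<phi> a o\<^sub>L induced t \<phi> b" for a b
    by (rule blinfun_eq_on_dense[OF tD(3)]) (auto simp: * D(6))
  have scale: "induced t \<phi> (c *\<^sub>C a) x = c *\<^sub>C induced t \<phi> a x" for c a x
    by (rule bounded_linear_eq_on_dense[OF tD(3) blinfun.bounded_linear_right
          bounded_linear_compose[OF bounded_linear_scaleC blinfun.bounded_linear_right]])
       (auto simp: * D(5) cbilinear_scaleC_left[OF tD(1)])
  have adj: "cinner (induced t \<phi> a x) y = cinner x (induced t \<phi> (star a) y)" for a x y
    by (rule adjoint_on_dense[OF tD(3) tD(3)]) (auto simp: * tD(2) D(7))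
  show "star_representation (induced t \<phi>)"
    unfolding star_representation_def using * add mult scale adj by simp
qed

lemma module_induced:
  assumes \<psi>: "correspondence \<psi> ractY ipY" and Z: "correspondence \<phi> ractZ ipZ"
    and t: "module_tensor ipY \<phi> ractZ ipZ t ractT ipT"
  shows "induced t \<psi> a (t y z) = t (\<psi> a y) z"
proof -
  note D = correspondenceD[OF \<psi>] and tD = module_tensorD[OF t]
  interpret semi_inner ipT 4 by (rule semi_inner_module[OF tD(1)])
  show ?thesis
    by (rule induced_exists[OF tD(2,5) norm_module_tensor_le[OF D(1) Z t] _ D(2,6)])
       (simp_all add: tD(3) D(7))
qed

lemma intertwiner_adjoint:
  assumes \<pi>1: "star_representation \<pi>1" and \<pi>2: "star_representation \<pi>2"
    and Z: "Z \<in> bounded_ops" and intertwines: "\<And>a. Z o\<^sub>L \<pi>1 a = \<pi>2 a o\<^sub>L Z"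
  shows "hadj Z o\<^sub>L \<pi>2 a = \<pi>1 a o\<^sub>L hadj Z"
proof (intro blinfun_eqI cinner_ext)
  fix x y
  have "cinner x (hadj Z (\<pi>2 a y)) = cinner (\<pi>2 (star a) (Z x)) y"
    by (simp add: cinner_hadj[OF Z, symmetric] star_representationD(5)[OF \<pi>2] star_star)
  also have "\<pi>2 (star a) (Z x) = Z (\<pi>1 (star a) x)"
    using intertwines[of "star a"] by (metis blinfun_apply_blinfun_compose)
  also have "cinner \<dots> y = cinner x (\<pi>1 a (hadj Z y))"
    by (simp add: cinner_hadj[OF Z] star_representationD(5)[OF \<pi>1] star_star)
  finally show "cinner x ((hadj Z o\<^sub>L \<pi>2 a) y) = cinner x ((\<pi>1 a o\<^sub>L hadj Z) y)" by simp
qed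

text \<open>The squared modulus of I \<otimes> Z is I \<otimes> Q with Q =
  \<open>hadj Z o\<^sub>L Z\<close>. Both Gram identities hold because Z and its adjoint pass
  through the operators \<pi> \<langle>x, x'\<rangle> inside the inner products.\<close>

lemma ampliation:
  fixes t1 :: "'y::cbanach \<Rightarrow> 'k1::chilbert_space \<Rightarrow> 't1::chilbert_space"
    and t2 :: "'y \<Rightarrow> 'k2::chilbert_space \<Rightarrow> 't2::chilbert_space"
  assumes H: "hilbert_module ract ip"
    and \<pi>1: "star_representation \<pi>1" and t1: "hilbert_tensor ip \<pi>1 t1"
    and \<pi>2: "star_representation \<pi>2" and t2: "hilbert_tensor ip \<pi>2 t2"
    and Z: "Z \<in> bounded_ops" and intertwines: "\<And>a. Z o\<^sub>L \<pi>1 a = \<pi>2 a o\<^sub>L Z"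
  shows "tensor_op t1 t2 id_blinfun Z \<in> bounded_ops"
    and "tensor_op t1 t2 id_blinfun Z (t1 x k) = t2 x (Z k)"
    and "norm (tensor_op t1 t2 id_blinfun Z) \<le> norm Z"
proof -
  note D1 = hilbert_tensorD[OF t1] and D2 = hilbert_tensorD[OF t2]
  interpret semi_inner "cinner :: 't1 \<Rightarrow> 't1 \<Rightarrow> complex" 1 by (rule semi_inner_cinner)
  define Q where "Q = hadj Z o\<^sub>L Z"
  have Z_comm: "Z (\<pi>1 a k) = \<pi>2 a (Z k)" for a k
    using intertwines[of a] by (metis blinfun_apply_blinfun_compose)
  have adj_comm: "hadj Z (\<pi>2 a k) = \<pi>1 a (hadj Z k)" for a k
    using intertwiner_adjoint[OF \<pi>1 \<pi>2 Z intertwines] by (metis blinfun_apply_blinfun_compose)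
  have gram: "cinner (t2 x (Z k)) (t2 x' (Z k')) = cinner (t1 x k) (t1 x' (Q k'))" for x k x' k'
    by (simp add: D1(2) D2(2) Q_def cinner_hadj[OF Z] adj_comm)
  have sym: "cinner (t1 x (Q k)) (t1 x' k') = cinner (t1 x k) (t1 x' (Q k'))" for x k x' k'
    by (simp add: D1(2) Q_def cinner_hadj_left[OF Z] cinner_hadj[OF Z] adj_comm Z_comm)
  have *: "tensor_op t1 t2 id_blinfun Z \<in> bounded_ops"
    "tensor_op t1 t2 id_blinfun Z (t1 x k) = t2 x (Z k)"
    "norm (tensor_op t1 t2 id_blinfun Z) \<le> 1 * sqrt (norm (id_blinfun :: 'y \<Rightarrow>\<^sub>L 'y) * norm Q)" for x k
    using tensor_op_exists[OF semi_inner_cinner D1(1) D2(1) D1(3) norm_hilbert_tensor_le[OF H \<pi>1 t1],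
        of id_blinfun Z id_blinfun Q] gram sym by simp_all
  show "tensor_op t1 t2 id_blinfun Z \<in> bounded_ops"
    "tensor_op t1 t2 id_blinfun Z (t1 x k) = t2 x (Z k)" by (fact *)+
  have "norm Q \<le> norm Z * norm Z"
    using norm_blinfun_compose[of "hadj Z" Z] by (simp add: Q_def norm_hadj[OF Z])
  \<comment> \<open>On a trivial module the identity has norm 0, hence only an inequality.\<close>
  moreover have "norm (id_blinfun :: 'y \<Rightarrow>\<^sub>L 'y) \<le> 1" by (rule norm_blinfun_id_le)
  ultimately have "norm (id_blinfun :: 'y \<Rightarrow>\<^sub>L 'y) * norm Q \<le> 1 * (norm Z * norm Z)"
    by (intro mult_mono) simp_all
  then have "sqrt (norm (id_blinfun :: 'y \<Rightarrow>\<^sub>L 'y) * norm Q) \<le> norm Z"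
    by (intro real_le_lsqrt) (simp_all add: power2_eq_square)
  then show "norm (tensor_op t1 t2 id_blinfun Z) \<le> norm Z" using *(3) by simp
qed

section \<open>Creation and annihilation operators\<close>

text \<open>Defined as the adjoint of k \<mapsto> x \<otimes> k rather than by y \<otimes> k
  \<mapsto> \<pi> \<langle>x, y\<rangle> k, so that boundedness needs no further extension
  argument.\<close>

definition annihilation :: "('y::cbanach \<Rightarrow> 'k::chilbert_space \<Rightarrow> 't::chilbert_space) \<Rightarrow> 'y \<Rightarrow> ('t \<Rightarrow>\<^sub>L 'k)"
  where "annihilation t x = hadj (Blinfun (t x))"

lemma creation:
  assumes H: "hilbert_module ract ip" and \<pi>: "star_representation \<pi>" and t: "hilbert_tensor ip \<pi> t"
  shows "blinfun_apply (Blinfun (t x)) = t x" and "Blinfun (t x) \<in> bounded_ops"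
proof -
  have "clinear (t x)" using hilbert_tensorD(1)[OF t] by (simp add: cbilinear_def)
  moreover have "norm (t x k) \<le> norm k * (2 * norm x)" for k
    using norm_hilbert_tensor_le[OF H \<pi> t, of x k] by (simp add: mult_ac)
  ultimately show "blinfun_apply (Blinfun (t x)) = t x" "Blinfun (t x) \<in> bounded_ops"
    using clinear_Blinfun by blast+
qed

lemma hilbert_tensor_bounded_linear:
  assumes H: "hilbert_module ract ip" and \<pi>: "star_representation \<pi>" and t: "hilbert_tensor ip \<pi> t"
  shows "bounded_linear (\<lambda>y. t y k)" and "bounded_linear (t y)"
proof -
  note tD = hilbert_tensorD(1)[OF t]
  show "bounded_linear (\<lambda>y. t y k)"
    by (rule bounded_linear_intro[where K = "2 * norm k"])
       (use norm_hilbert_tensor_le[OF H \<pi> t, of _ k] in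
         \<open>simp_all add: scaleR_scaleC mult_ac cbilinear_add_left[OF tD] cbilinear_scaleC_left[OF tD]\<close>)
  show "bounded_linear (t y)"
    by (metis creation(1)[OF H \<pi> t] blinfun.bounded_linear_right)
qed

lemma annihilation:
  assumes H: "hilbert_module ract ip" and \<pi>: "star_representation \<pi>" and t: "hilbert_tensor ip \<pi> t"
  shows "annihilation t x \<in> bounded_ops"
    and "cinner (t x k) \<xi> = cinner k (annihilation t x \<xi>)"
    and "cinner \<xi> (t x k) = cinner (annihilation t x \<xi>) k"
    and "annihilation t x (t y k) = \<pi> (ip x y) k"
proof -
  note C = creation[OF H \<pi> t]
  show *: "annihilation t x \<in> bounded_ops"
    "cinner (t x k) \<xi> = cinner k (annihilation t x \<xi>)" for k \<xi>
    using hadj_bounded_ops[OF C(2)] cinner_hadj[OF C(2)] by (simp_all add: annihilation_def C(1))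
  show "cinner \<xi> (t x k) = cinner (annihilation t x \<xi>) k" for \<xi> k
    by (metis *(2) cinner_commute)
  show "annihilation t x (t y k) = \<pi> (ip x y) k"
    by (rule cinner_ext) (simp add: *(2)[symmetric] hilbert_tensorD(2)[OF t])
qed

text \<open>Balancedness is forced by the Gram kernel: both sides have the same inner products with
  all elementary tensors.\<close>

lemma hilbert_tensor_balanced:
  assumes H: "hilbert_module ract ip" and \<pi>: "star_representation \<pi>" and t: "hilbert_tensor ip \<pi> t"
  shows "t (ract x a) k = t x (\<pi> a k)"
  by (rule cinner_ext_dense[OF hilbert_tensorD(3)[OF t]])
     (auto simp: hilbert_tensorD(2)[OF t] hilbert_moduleD(5)[OF H] star_representationD(4)[OF \<pi>])

lemma annihilation_ract:
  assumes H: "hilbert_module ract ip" and \<pi>: "star_representation \<pi>" and t: "hilbert_tensor ip \<pi> t"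
  shows "annihilation t (ract x (star a)) \<xi> = \<pi> a (annihilation t x \<xi>)"
proof (rule cinner_ext)
  fix k
  have "cinner k (annihilation t (ract x (star a)) \<xi>) = cinner (t x (\<pi> (star a) k)) \<xi>"
    by (simp add: annihilation(2)[OF H \<pi> t, symmetric] hilbert_tensor_balanced[OF H \<pi> t])
  also have "\<dots> = cinner k (\<pi> a (annihilation t x \<xi>))"
    by (simp add: annihilation(2)[OF H \<pi> t] star_representationD(5)[OF \<pi>] star_star)
  finally show "cinner k (annihilation t (ract x (star a)) \<xi>) = cinner k (\<pi> a (annihilation t x \<xi>))" .
qed

text \<open>Creation after annihilation factors x\<langle>y, -\<rangle> \<otimes> I through K. This
  turns intertwining the action of M into a relation between annihilation operators.\<close>

lemma rank_one_action:
  assumes \<phi>: "correspondence \<phi> ract ip" and \<pi>: "star_representation \<pi>" and t: "hilbert_tensor ip \<pi> t"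
    and a: "\<And>z. \<phi> a z = ract x (ip y z)"
  shows "induced t \<phi> a \<xi> = t x (annihilation t y \<xi>)"
proof -
  note H = correspondenceD(1)[OF \<phi>]
  note C = creation[OF H \<pi> t]
  have "induced t \<phi> a = Blinfun (t x) o\<^sub>L annihilation t y"
    by (rule blinfun_eq_on_dense[OF hilbert_tensorD(3)[OF t]])
       (auto simp: hilbert_induced(2)[OF \<phi> \<pi> t] a C(1) annihilation(4)[OF H \<pi> t]
         hilbert_tensor_balanced[OF H \<pi> t])
  then show ?thesis by (simp add: C(1))
qed

text \<open>Here the surjectivity of the left action onto the compact operators enters; it allows
  intertwiners for the algebra to be tested on rank one operators.\<close>

lemma rank_one_exists:
  assumes X: "equivalence_bimodule \<phi> ract ip"
  shows "\<exists>a. \<forall>z. \<phi> a z = ract x (ip y z)"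
proof -
  have H: "hilbert_module ract ip"
    using X correspondenceD(1) unfolding equivalence_bimodule_def by blast
  note D = hilbert_moduleD[OF H]
  interpret semi_inner ip 4 by (rule semi_inner_module[OF H])
  have lin: "clinear (\<lambda>z. ract x (ip y z))"
    using D(1) by (simp add: clinear_def cbilinear_def D(3,4))
  have bound: "norm (ract x (ip y z)) \<le> norm z * (norm x * (4 * norm y))" for z
  proof -
    have "norm (ract x (ip y z)) \<le> norm x * norm (ip y z)" by (rule norm_ract_le[OF H])
    also have "\<dots> \<le> norm x * (4 * norm y * norm z)" by (intro mult_left_mono ip_bound) simp
    finally show ?thesis by (simp add: mult_ac)
  qed
  have "Blinfun (\<lambda>z. ract x (ip y z)) \<in> compact_ops ract ip"
    unfolding compact_ops_def using clinear_Blinfun(1)[OF lin bound]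
    by (intro in_closure_span) auto
  then obtain a where "\<phi> a = Blinfun (\<lambda>z. ract x (ip y z))"
    using X unfolding equivalence_bimodule_def bij_betw_def by (metis (no_types, lifting) imageE)
  then have "\<forall>z. \<phi> a z = ract x (ip y z)" by (simp add: clinear_Blinfun(1)[OF lin bound])
  then show ?thesis by blast
qed

text \<open>Fullness and the continuity of a \<mapsto> \<pi> a k reduce everything to inner
  products. The vectors \<pi> \<langle>x, y\<rangle> k are values of annihilation operators at
  elementary tensors, so the ranges of these operators jointly span a dense subspace.\<close>

lemma nondegenerate_full:
  assumes \<pi>: "star_representation \<pi>" and nondeg: "nondegenerate \<pi>" and full: "full_module ip"
  shows "closure (span {\<pi> (ip x y) k |x y k. True}) = UNIV"
proof -
  have "{\<pi> a k |a k. True} \<subseteq> closure (span {\<pi> (ip x y) k |x y k. True})"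
  proof clarify
    fix a k
    have "bounded_linear (\<lambda>a. \<pi> a k)"
      by (rule bounded_linear_intro[where K = "2 * norm k"])
         (use star_representationD[OF \<pi>] norm_star_representation_le[OF \<pi>, of _ k] in
           \<open>simp_all add: blinfun.add_left scaleR_scaleC mult_ac\<close>)
    then show "\<pi> a k \<in> closure (span {\<pi> (ip x y) k |x y k. True})"
      by (rule closure_span_image[where A = "{ip x y |x y. True}"])
         (use full in \<open>auto simp: full_module_def intro!: in_closure_span\<close>)
  qed
  from closure_span_least[OF this] show ?thesis
    using nondeg unfolding nondegenerate_def by blast
qed

text \<open>Transfers nondegeneracy from the left action on F to the representation on F \<otimes>
  H, where the imprimitivity argument needs it.\<close>

lemma nondegenerate_induced:
  assumes \<phi>: "correspondence \<phi> ract ip" and \<pi>: "star_representation \<pi>" and t: "hilbert_tensor ip \<pi> t"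
    and nondeg: "nondegenerate \<phi>"
  shows "nondegenerate (induced t \<phi>)"
proof -
  note tD = hilbert_tensorD[OF t]
  have "{t y k |y k. True} \<subseteq> closure (span {induced t \<phi> a v |a v. True})"
  proof clarify
    fix y k
    have "bounded_linear (\<lambda>y. t y k)"
      by (rule hilbert_tensor_bounded_linear(1)[OF correspondenceD(1)[OF \<phi>] \<pi> t])
    then show "t y k \<in> closure (span {induced t \<phi> a v |a v. True})"
    proof (rule closure_span_image[where A = "{\<phi> a y |a y. True}"])
      show "y \<in> closure (span {\<phi> a y |a y. True})"
        using nondeg unfolding nondegenerate_def by blast
      fix u assume "u \<in> {\<phi> a y |a y. True}"
      then obtain a y' where "u = \<phi> a y'" by blast
      then have "t u k = induced t \<phi> a (t y' k)" by (simp add: hilbert_induced(2)[OF \<phi> \<pi> t])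
      then show "t u k \<in> closure (span {induced t \<phi> a v |a v. True})"
        by (intro in_closure_span) blast
    qed
  qed
  from closure_span_least[OF this] show ?thesis
    using tD(3) unfolding nondegenerate_def by blast
qed

section \<open>Imprimitivity\<close>

text \<open>An operator \<open>R\<close> commuting with \<open>\<K>(X) \<otimes> I\<close> has the form \<open>I \<otimes> Z\<close>, where \<open>Z\<close> is determined by
  \<open>Z (c x \<xi>) = c' x (R \<xi>)\<close> for the annihilation operators \<open>c x\<close>, \<open>c' x\<close>.  The same power iteration
  as for \<open>I \<otimes> Z\<close> itself shows that \<open>Z\<close> is well defined and bounded by \<open>norm R\<close>.\<close>

lemma imprimitivity:
  fixes t1 :: "'x::cbanach \<Rightarrow> 'k1::chilbert_space \<Rightarrow> 't1::chilbert_space"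
    and t2 :: "'x \<Rightarrow> 'k2::chilbert_space \<Rightarrow> 't2::chilbert_space"
  assumes X: "equivalence_bimodule \<phi> ract ip"
    and \<pi>1: "star_representation \<pi>1" and t1: "hilbert_tensor ip \<pi>1 t1" and nondeg: "nondegenerate \<pi>1"
    and \<pi>2: "star_representation \<pi>2" and t2: "hilbert_tensor ip \<pi>2 t2"
    and R: "R \<in> bounded_ops" and intertwines: "\<And>a. R o\<^sub>L induced t1 \<phi> a = induced t2 \<phi> a o\<^sub>L R"
  shows "\<exists>Z \<in> bounded_ops. norm Z \<le> norm R \<and> (\<forall>a. Z o\<^sub>L \<pi>1 a = \<pi>2 a o\<^sub>L Z)
    \<and> (\<forall>x k. R (t1 x k) = t2 x (Z k))"
proof -
  have \<phi>: "correspondence \<phi> ract ip" and full: "full_module ip"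
    using X unfolding equivalence_bimodule_def by blast+
  note H = correspondenceD(1)[OF \<phi>]
  note ind1 = hilbert_induced[OF \<phi> \<pi>1 t1] and ind2 = hilbert_induced[OF \<phi> \<pi>2 t2]
  note A1 = annihilation[OF H \<pi>1 t1] and A2 = annihilation[OF H \<pi>2 t2]
  interpret semi_inner "cinner :: 'k1 \<Rightarrow> 'k1 \<Rightarrow> complex" 1 by (rule semi_inner_cinner)
  define c1 where "c1 = annihilation t1"
  define c2 where "c2 = annihilation t2"
  have rank1: "R (t1 x (c1 y \<xi>)) = t2 x (c2 y (R \<xi>))" for x y \<xi>
  proof -
    obtain a where a: "\<And>z. \<phi> a z = ract x (ip y z)" using rank_one_exists[OF X] by blast
    show ?thesis
      using intertwines[of a] rank_one_action[OF \<phi> \<pi>1 t1 a, of \<xi>] rank_one_action[OF \<phi> \<pi>2 t2 a, of "R \<xi>"]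
      unfolding c1_def c2_def by (metis blinfun_apply_blinfun_compose)
  qed
  have rank2: "hadj R (t2 x (c2 y \<xi>)) = t1 x (c1 y (hadj R \<xi>))" for x y \<xi>
  proof -
    obtain a where a: "\<And>z. \<phi> a z = ract x (ip y z)" using rank_one_exists[OF X] by blast
    show ?thesis
      using intertwiner_adjoint[OF ind1(3) ind2(3) R intertwines, of a]
        rank_one_action[OF \<phi> \<pi>2 t2 a, of \<xi>] rank_one_action[OF \<phi> \<pi>1 t1 a, of "hadj R \<xi>"]
      unfolding c1_def c2_def by (metis blinfun_apply_blinfun_compose)
  qed
  define Q where "Q = hadj R o\<^sub>L R"
  \<comment> \<open>Indices are pairs (x, \<xi>) with \<xi> in X \<otimes> K. There R is already an
    operator, so the index map of the iteration can be \<open>Q\<close> on the second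
    component.\<close>
  define g where "g i = c1 (fst i) (snd i)" for i
  define f where "f i = c2 (fst i) (R (snd i))" for i
  have dense: "closure (span (range g)) = UNIV"
  proof -
    have "{\<pi>1 (ip x y) k |x y k. True} \<subseteq> closure (span (range g))"
    proof clarify
      fix x y k
      have "g (x, t1 y k) = \<pi>1 (ip x y) k" by (simp add: g_def c1_def A1(4))
      then show "\<pi>1 (ip x y) k \<in> closure (span (range g))"
        by (metis in_closure_span rangeI)
    qed
    from closure_span_least[OF this] show ?thesis
      using nondegenerate_full[OF \<pi>1 nondeg full] by blast
  qed
  \<comment> \<open>Annihilation at x moves across the inner product as creation,
    \<open>rank2\<close> carries \<open>hadj R\<close> past the creation operator, and the move is
    then reversed.\<close>
  have f_gram: "cinner (f i) (f j) = cinner (g i) (g (apsnd Q j))" for i j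
  proof -
    have "cinner (f i) (f j) = cinner (R (snd i)) (t2 (fst i) (c2 (fst j) (R (snd j))))"
      by (simp add: f_def c2_def A2(3))
    also have "\<dots> = cinner (snd i) (t1 (fst i) (c1 (fst j) (Q (snd j))))"
      by (simp add: cinner_hadj[OF R] rank2 Q_def)
    also have "\<dots> = cinner (g i) (g (apsnd Q j))"
      by (simp add: g_def c1_def A1(3))
    finally show ?thesis .
  qed
  have "cinner (g (apsnd Q i)) (g j) = cinner (f i) (f j)" for i j
  proof -
    have "cinner (g (apsnd Q i)) (g j) = cinner (Q (snd i)) (t1 (fst i) (c1 (fst j) (snd j)))"
      by (simp add: g_def c1_def A1(3))
    also have "\<dots> = cinner (R (snd i)) (t2 (fst i) (c2 (fst j) (R (snd j))))"
      by (simp add: cinner_hadj_left[OF R] rank1 Q_def)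
    also have "\<dots> = cinner (f i) (f j)" by (simp add: f_def c2_def A2(3))
    finally show ?thesis .
  qed
  then have sym: "cinner (g (apsnd Q i)) (g j) = cinner (g i) (g (apsnd Q j))" for i j
    by (simp only: f_gram)
  have "\<exists>Z. Z \<in> bounded_ops \<and> (\<forall>i. Z (g i) = f i) \<and> norm Z \<le> norm R"
  proof (rule bounded_extension[OF dense])
    show "\<exists>j. g j = a *\<^sub>C g i \<and> f j = a *\<^sub>C f i" for a i
      by (rule exI[of _ "(fst i, a *\<^sub>C snd i)"])
         (simp add: g_def f_def c1_def c2_def bounded_ops_scaleC A1(1) A2(1) R)
    have "norm Q \<le> norm R * norm R"
      using norm_blinfun_compose[of "hadj R" R] by (simp add: Q_def norm_hadj[OF R])
    then have Q_le: "sqrt (norm Q) \<le> norm R"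
      by (intro real_le_lsqrt) (simp_all add: power2_eq_square)
    show "norm (\<Sum>i\<leftarrow>l. f i) \<le> norm R * norm (\<Sum>i\<leftarrow>l. g i)" for l
    proof -
      have "norm (\<Sum>i\<leftarrow>l. f i) \<le> 1 * sqrt (norm Q) * norm (\<Sum>i\<leftarrow>l. g i)"
      proof (rule gram_bound[OF semi_inner_cinner, where p = "apsnd Q"])
        fix i :: "'x \<times> 't1"
        have iter: "(apsnd Q ^^ n) i = (fst i, (blinfun_apply Q ^^ n) (snd i))" for n
          by (induction n) simp_all
        have "norm (g ((apsnd Q ^^ n) i)) \<le> norm (c1 (fst i)) * norm (snd i) * norm Q ^ n" for n
        proof -
          have "norm (g ((apsnd Q ^^ n) i)) \<le> norm (c1 (fst i)) * norm ((blinfun_apply Q ^^ n) (snd i))"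
            unfolding iter g_def fst_conv snd_conv by (rule norm_blinfun)
          also have "\<dots> \<le> norm (c1 (fst i)) * (norm Q ^ n * norm (snd i))"
            by (intro mult_left_mono norm_blinfun_funpow) simp
          finally show ?thesis by (simp add: mult_ac)
        qed
        then show "\<exists>C. \<forall>n. norm (g ((apsnd Q ^^ n) i)) \<le> C * norm Q ^ n" by blast
      qed (simp_all add: f_gram sym)
      also have "\<dots> \<le> norm R * norm (\<Sum>i\<leftarrow>l. g i)"
        using Q_le by (simp add: mult_right_mono)
      finally show ?thesis .
    qed
  qed simp
  then obtain Z where Z: "Z \<in> bounded_ops" "\<And>i. Z (g i) = f i" "norm Z \<le> norm R" by blast
  have Zc: "Z (c1 x \<xi>) = c2 x (R \<xi>)" for x \<xi>
    using Z(2)[of "(x, \<xi>)"] by (simp add: g_def f_def)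
  have "Z o\<^sub>L \<pi>1 a = \<pi>2 a o\<^sub>L Z" for a
  proof (rule blinfun_eq_on_dense[OF dense], clarify)
    fix x \<xi>
    \<comment> \<open>The representation is absorbed into the index: annihilation at x followed by
      \<pi> a is annihilation at x times \<open>star a\<close>, so Z is again evaluated at a
      generator.\<close>
    have "Z (\<pi>1 a (c1 x \<xi>)) = \<pi>2 a (c2 x (R \<xi>))"
      unfolding c1_def c2_def annihilation_ract[OF H \<pi>1 t1, symmetric]
        annihilation_ract[OF H \<pi>2 t2, symmetric]
      by (simp add: Zc[unfolded c1_def c2_def])
    then show "(Z o\<^sub>L \<pi>1 a) (g (x, \<xi>)) = (\<pi>2 a o\<^sub>L Z) (g (x, \<xi>))"
      by (simp add: g_def Zc)
  qed
  moreover have "R (t1 x k) = t2 x (Z k)" for x k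
  proof -
    note C1 = creation[OF H \<pi>1 t1, of x] and C2 = creation[OF H \<pi>2 t2, of x]
    have "R o\<^sub>L Blinfun (t1 x) = Blinfun (t2 x) o\<^sub>L Z"
      by (rule blinfun_eq_on_dense[OF dense]) (auto simp: C1 C2 g_def rank1 Zc)
    then have "(R o\<^sub>L Blinfun (t1 x)) k = (Blinfun (t2 x) o\<^sub>L Z) k" by (rule arg_cong)
    then show ?thesis by (simp add: C1 C2)
  qed
  ultimately show ?thesis using Z by blast
qed

text \<open>S (\<pi>1 \<langle>x, y\<rangle> k) is annihilation at x applied to y \<otimes> S k, so
  I \<otimes> S determines S on a dense span.\<close>

lemma intertwiner_unique:
  assumes H: "hilbert_module ract ip" and full: "full_module ip"
    and \<pi>1: "star_representation \<pi>1" and nondeg: "nondegenerate \<pi>1"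
    and \<pi>2: "star_representation \<pi>2" and t2: "hilbert_tensor ip \<pi>2 t2"
    and S: "\<And>a. S o\<^sub>L \<pi>1 a = \<pi>2 a o\<^sub>L S" and T: "\<And>a. T o\<^sub>L \<pi>1 a = \<pi>2 a o\<^sub>L T"
    and eq: "\<And>x k. t2 x (S k) = t2 x (T k)"
  shows "S = T"
proof (rule blinfun_eq_on_dense[OF nondegenerate_full[OF \<pi>1 nondeg full]], clarify)
  fix x y k
  have "S (\<pi>1 (ip x y) k) = annihilation t2 x (t2 y (S k))"
    using S[of "ip x y"] by (metis annihilation(4)[OF H \<pi>2 t2] blinfun_apply_blinfun_compose)
  also have "\<dots> = annihilation t2 x (t2 y (T k))" by (simp only: eq)
  also have "\<dots> = T (\<pi>1 (ip x y) k)"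
    using T[of "ip x y"] by (metis annihilation(4)[OF H \<pi>2 t2] blinfun_apply_blinfun_compose)
  finally show "S (\<pi>1 (ip x y) k) = T (\<pi>1 (ip x y) k)" .
qed

text \<open>If only the target representation is nondegenerate, the adjoint of R is an intertwiner
  starting from it, hence of the form I \<otimes> z, and R is I \<otimes>
  \<open>hadj z\<close>.\<close>

lemma imprimitivity_nondegenerate_either:
  fixes t1 :: "'x::cbanach \<Rightarrow> 'k1::chilbert_space \<Rightarrow> 't1::chilbert_space"
    and t2 :: "'x \<Rightarrow> 'k2::chilbert_space \<Rightarrow> 't2::chilbert_space"
  assumes X: "equivalence_bimodule \<phi> ract ip"
    and \<pi>1: "star_representation \<pi>1" and t1: "hilbert_tensor ip \<pi>1 t1"
    and \<pi>2: "star_representation \<pi>2" and t2: "hilbert_tensor ip \<pi>2 t2"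
    and nondeg: "nondegenerate \<pi>1 \<or> nondegenerate \<pi>2"
    and R: "R \<in> bounded_ops" and intertwines: "\<And>a. R o\<^sub>L induced t1 \<phi> a = induced t2 \<phi> a o\<^sub>L R"
  shows "\<exists>Z \<in> bounded_ops. norm Z \<le> norm R \<and> (\<forall>a. Z o\<^sub>L \<pi>1 a = \<pi>2 a o\<^sub>L Z)
    \<and> (\<forall>x k. R (t1 x k) = t2 x (Z k))"
proof (cases "nondegenerate \<pi>1")
  case True
  from imprimitivity[OF X \<pi>1 t1 this \<pi>2 t2 R intertwines] show ?thesis .
next
  case False
  then have nondeg2: "nondegenerate \<pi>2" using nondeg by blast
  have \<phi>: "correspondence \<phi> ract ip" using X unfolding equivalence_bimodule_def by blast
  note ind1 = hilbert_induced[OF \<phi> \<pi>1 t1] and ind2 = hilbert_induced[OF \<phi> \<pi>2 t2]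
  from imprimitivity[OF X \<pi>2 t2 nondeg2 \<pi>1 t1 hadj_bounded_ops[OF R]
      intertwiner_adjoint[OF ind1(3) ind2(3) R intertwines]]
  obtain z where z: "z \<in> bounded_ops" "norm z \<le> norm (hadj R)"
    and z_int: "\<And>a. z o\<^sub>L \<pi>2 a = \<pi>1 a o\<^sub>L z"
    and z_eq: "\<And>x k. hadj R (t2 x k) = t1 x (z k)" by blast
  have "R (t1 x k) = t2 x (hadj z k)" for x k
  proof (rule cinner_ext_dense[OF hilbert_tensorD(3)[OF t2]], clarify)
    fix y h
    have z_app: "z (\<pi>2 a h) = \<pi>1 a (z h)" for a
      using z_int[of a] by (metis blinfun_apply_blinfun_compose)
    have "hadj z (\<pi>1 a k) = \<pi>2 a (hadj z k)" for a
      using intertwiner_adjoint[OF \<pi>2 \<pi>1 z(1) z_int, of a] by (metis blinfun_apply_blinfun_compose)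
    then show "cinner (t2 y h) (R (t1 x k)) = cinner (t2 y h) (t2 x (hadj z k))"
      by (simp add: cinner_hadj_left[OF R, symmetric] z_eq hilbert_tensorD(2)[OF t1]
          hilbert_tensorD(2)[OF t2] cinner_hadj[OF z(1)])
  qed
  then show ?thesis
    using hadj_bounded_ops[OF z(1)] z(2) norm_hadj[OF z(1)] norm_hadj[OF R]
      intertwiner_adjoint[OF \<pi>2 \<pi>1 z(1) z_int]
    by (intro bexI[of _ "hadj z"]) auto
qed

text \<open>The norm cannot drop: I \<otimes> Z is itself an intertwiner for M, so imprimitivity
  returns Z' with I \<otimes> Z' = I \<otimes> Z and norm Z' \<le> norm (I \<otimes> Z), and
  nondegeneracy forces Z' = Z.\<close>

lemma norm_ampliation:
  fixes t1 :: "'x::cbanach \<Rightarrow> 'k1::chilbert_space \<Rightarrow> 't1::chilbert_space"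
    and t2 :: "'x \<Rightarrow> 'k2::chilbert_space \<Rightarrow> 't2::chilbert_space"
  assumes X: "equivalence_bimodule \<phi> ract ip"
    and \<pi>1: "star_representation \<pi>1" and t1: "hilbert_tensor ip \<pi>1 t1"
    and \<pi>2: "star_representation \<pi>2" and t2: "hilbert_tensor ip \<pi>2 t2"
    and nondeg: "nondegenerate \<pi>1 \<or> nondegenerate \<pi>2"
    and Z: "Z \<in> bounded_ops" and intertwines: "\<And>a. Z o\<^sub>L \<pi>1 a = \<pi>2 a o\<^sub>L Z"
  shows "tensor_op t1 t2 id_blinfun Z o\<^sub>L induced t1 \<phi> a = induced t2 \<phi> a o\<^sub>L tensor_op t1 t2 id_blinfun Z"
    and "norm (tensor_op t1 t2 id_blinfun Z) = norm Z"
proof -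
  have \<phi>: "correspondence \<phi> ract ip" and full: "full_module ip"
    using X unfolding equivalence_bimodule_def by blast+
  note H = correspondenceD(1)[OF \<phi>]
  note ind1 = hilbert_induced[OF \<phi> \<pi>1 t1] and ind2 = hilbert_induced[OF \<phi> \<pi>2 t2]
  define T where "T = tensor_op t1 t2 id_blinfun Z"
  have T: "T \<in> bounded_ops" "\<And>x k. T (t1 x k) = t2 x (Z k)" "norm T \<le> norm Z"
    unfolding T_def by (rule ampliation[OF H \<pi>1 t1 \<pi>2 t2 Z intertwines])+
  have comm: "T o\<^sub>L induced t1 \<phi> a = induced t2 \<phi> a o\<^sub>L T" for a
    by (rule blinfun_eq_on_dense[OF hilbert_tensorD(3)[OF t1]]) (auto simp: ind1(2) ind2(2) T(2))
  then show "tensor_op t1 t2 id_blinfun Z o\<^sub>L induced t1 \<phi> a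
    = induced t2 \<phi> a o\<^sub>L tensor_op t1 t2 id_blinfun Z" by (simp add: T_def)
  from imprimitivity_nondegenerate_either[OF X \<pi>1 t1 \<pi>2 t2 nondeg T(1) comm]
  obtain Z' where Z': "Z' \<in> bounded_ops" "norm Z' \<le> norm T"
    and Z'_int: "\<And>a. Z' o\<^sub>L \<pi>1 a = \<pi>2 a o\<^sub>L Z'" and Z'_eq: "\<And>x k. T (t1 x k) = t2 x (Z' k)" by blast
  have eq: "t2 x (Z' k) = t2 x (Z k)" for x k by (simp add: Z'_eq[symmetric] T(2))
  have "Z' = Z"
  proof (cases "nondegenerate \<pi>1")
    case True
    show ?thesis
      by (rule intertwiner_unique[OF H full \<pi>1 True \<pi>2 t2 Z'_int intertwines eq])
  next
    case False
    then have nondeg2: "nondegenerate \<pi>2" using nondeg by blast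
    have "Z' k = Z k" for k
    proof (rule cinner_ext_dense[OF nondegenerate_full[OF \<pi>2 nondeg2 full]], clarify)
      fix x y h
      \<comment> \<open>The right side sees v only through x \<otimes> v, while the vectors on the
        left span a dense subspace of the target.\<close>
      have "cinner (\<pi>2 (ip x y) h) v = cinner (t2 y h) (t2 x v)" for v
        by (metis hilbert_tensorD(2)[OF t2] star_representationD(5)[OF \<pi>2] hilbert_moduleD(6)[OF H] star_star)
      then show "cinner (\<pi>2 (ip x y) h) (Z' k) = cinner (\<pi>2 (ip x y) h) (Z k)"
        by (simp only: eq)
    qed
    then show ?thesis by (rule blinfun_eqI)
  qed
  then show "norm (tensor_op t1 t2 id_blinfun Z) = norm Z"
    using Z'(2) T(3) by (simp add: T_def)
qed

lemma blinfun_compose_assoc: "(f o\<^sub>L g) o\<^sub>L h = f o\<^sub>L (g o\<^sub>L h)"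
  by (rule blinfun_eqI) simp

lemma blinfun_compose_id [simp]: "f o\<^sub>L id_blinfun = f" "id_blinfun o\<^sub>L f = f"
  by (rule blinfun_eqI, simp)+

section \<open>Unitaries between tensor products\<close>

text \<open>Stated by norms and a two-sided inverse instead of inner products: the forms used to
  cancel unitaries in norms and to transport intertwiners back.\<close>

definition unitary_op :: "('k::cbanach \<Rightarrow>\<^sub>L 'l::cbanach) \<Rightarrow> bool" where
  "unitary_op T \<longleftrightarrow> T \<in> bounded_ops \<and> (\<forall>x. norm (T x) = norm x) \<and>
     (\<exists>S \<in> bounded_ops. T o\<^sub>L S = id_blinfun \<and> S o\<^sub>L T = id_blinfun)"

lemma unitary_op_compose:
  assumes "unitary_op S" and "unitary_op T"
  shows "unitary_op (S o\<^sub>L T)"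
proof -
  obtain S' where S': "S' \<in> bounded_ops" "S o\<^sub>L S' = id_blinfun" "S' o\<^sub>L S = id_blinfun"
    using assms(1) unfolding unitary_op_def by blast
  obtain T' where T': "T' \<in> bounded_ops" "T o\<^sub>L T' = id_blinfun" "T' o\<^sub>L T = id_blinfun"
    using assms(2) unfolding unitary_op_def by blast
  have "S (S' x) = x" "S' (S y) = y" "T (T' y) = y" "T' (T z) = z" for x y z
    using S'(2,3) T'(2,3) by (metis blinfun_apply_blinfun_compose blinfun_apply_id_blinfun)+
  then have "(S o\<^sub>L T) o\<^sub>L (T' o\<^sub>L S') = id_blinfun" "(T' o\<^sub>L S') o\<^sub>L (S o\<^sub>L T) = id_blinfun"
    by (auto intro!: blinfun_eqI)
  moreover have "T' o\<^sub>L S' \<in> bounded_ops" "S o\<^sub>L T \<in> bounded_ops"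
    using S' T' assms by (simp_all add: bounded_ops_compose unitary_op_def)
  ultimately show ?thesis
    using assms unfolding unitary_op_def by auto
qed

text \<open>Equal Gram kernels give a contraction in each direction; the two are mutually inverse,
  hence isometric.\<close>

lemma unitary_extension:
  fixes g :: "'i \<Rightarrow> 't::chilbert_space" and f :: "'i \<Rightarrow> 's::chilbert_space"
  assumes g: "closure (span (range g)) = UNIV" and f: "closure (span (range f)) = UNIV"
    and scale: "\<And>c i. \<exists>j. g j = c *\<^sub>C g i \<and> f j = c *\<^sub>C f i"
    and gram: "\<And>i j. cinner (f i) (f j) = cinner (g i) (g j)"
  shows "\<exists>T. unitary_op T \<and> (\<forall>i. T (g i) = f i)"
proof -
  have norm_eq: "norm (\<Sum>i\<leftarrow>l. f i) = norm (\<Sum>i\<leftarrow>l. g i)" for l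
    by (rule semi_inner.isometric_sum[OF semi_inner_cinner semi_inner_cinner gram])
  have "\<exists>T. T \<in> bounded_ops \<and> (\<forall>i. T (g i) = f i) \<and> norm T \<le> 1"
    by (rule bounded_extension[OF g scale]) (simp_all add: norm_eq)
  then obtain T where T: "T \<in> bounded_ops" "\<And>i. T (g i) = f i" "norm T \<le> 1" by blast
  have "\<exists>S. S \<in> bounded_ops \<and> (\<forall>i. S (f i) = g i) \<and> norm S \<le> 1"
    by (rule bounded_extension[OF f]) (use scale in \<open>auto simp: norm_eq\<close>)
  then obtain S where S: "S \<in> bounded_ops" "\<And>i. S (f i) = g i" "norm S \<le> 1" by blast
  have TS: "T o\<^sub>L S = id_blinfun" by (rule blinfun_eq_on_dense[OF f]) (auto simp: S T)
  have ST: "S o\<^sub>L T = id_blinfun" by (rule blinfun_eq_on_dense[OF g]) (auto simp: S T)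
  have "norm (T x) = norm x" for x
  proof (rule antisym)
    show "norm (T x) \<le> norm x" using norm_blinfun[of T x] T(3) mult_right_mono[of "norm T" 1 "norm x"] by simp
    have "x = S (T x)" using ST by (metis blinfun_apply_blinfun_compose blinfun_apply_id_blinfun)
    then show "norm x \<le> norm (T x)"
      using norm_blinfun[of S "T x"] S(3) mult_right_mono[of "norm S" 1 "norm (T x)"] by simp
  qed
  then show ?thesis using T S TS ST unfolding unitary_op_def by blast
qed

section \<open>Associativity and the operator W \<otimes> I\<close>

lemma dense_tensor_left:
  assumes t: "closure (span {t y z |y z. True}) = UNIV" and s: "closure (span {s w k |w k. True}) = UNIV"
    and bl: "\<And>k. bounded_linear (\<lambda>w. s w k)"
  shows "closure (span (range (\<lambda>(y, z, k). s (t y z) k))) = UNIV"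
proof -
  let ?B = "range (\<lambda>(y, z, k). s (t y z) k)"
  have gen: "s (t y z) k \<in> closure (span ?B)" for y z k
    by (rule in_closure_span, rule image_eqI[of _ _ "(y, z, k)"]) simp_all
  have "{s w k |w k. True} \<subseteq> closure (span ?B)"
  proof clarify
    fix w k
    show "s w k \<in> closure (span ?B)"
      by (rule closure_span_image[OF bl, where A = "{t y z |y z. True}"]) (use t gen in auto)
  qed
  from closure_span_least[OF this] s show ?thesis by blast
qed

lemma dense_tensor_right:
  assumes t: "closure (span {t z k |z k. True}) = UNIV" and s: "closure (span {s y v |y v. True}) = UNIV"
    and bl: "\<And>y. bounded_linear (s y)"
  shows "closure (span (range (\<lambda>(y, z, k). s y (t z k)))) = UNIV"
proof -
  let ?B = "range (\<lambda>(y, z, k). s y (t z k))"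
  have gen: "s y (t z k) \<in> closure (span ?B)" for y z k
    by (rule in_closure_span, rule image_eqI[of _ _ "(y, z, k)"]) simp_all
  have "{s y v |y v. True} \<subseteq> closure (span ?B)"
  proof clarify
    fix y v
    show "s y v \<in> closure (span ?B)"
      by (rule closure_span_image[OF bl, where A = "{t z k |z k. True}"]) (use t gen in auto)
  qed
  from closure_span_least[OF this] s show ?thesis by blast
qed

text \<open>Both bracketings have the Gram kernel \<langle>k, \<pi> \<langle>z, \<phi> \<langle>y,
  y'\<rangle> z'\<rangle> k'\<rangle>. The directions are treated separately because
  \<open>assoc_right\<close> and \<open>assoc_left\<close> are independent descriptions by
  \<open>THE\<close>.\<close>

lemma assoc_unitary:
  fixes tYZ_K :: "'yz::cbanach \<Rightarrow> 'k::chilbert_space \<Rightarrow> 's::chilbert_space"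
    and tY_ZK :: "'y::cbanach \<Rightarrow> 'zk::chilbert_space \<Rightarrow> 't::chilbert_space"
  assumes Y: "hilbert_module ractY ipY" and Z: "correspondence \<phi> ractZ ipZ"
    and YZ: "module_tensor ipY \<phi> ractZ ipZ tYZ ractT ipT" and \<pi>: "star_representation \<pi>"
    and YZ_K: "hilbert_tensor ipT \<pi> tYZ_K" and ZK: "hilbert_tensor ipZ \<pi> tZK"
    and Y_ZK: "hilbert_tensor ipY (induced tZK \<phi>) tY_ZK"
  shows "unitary_op (assoc_right tYZ tYZ_K tZK tY_ZK)"
    and "assoc_right tYZ tYZ_K tZK tY_ZK (tYZ_K (tYZ y z) k) = tY_ZK y (tZK z k)"
    and "unitary_op (assoc_left tYZ tYZ_K tZK tY_ZK)"
    and "assoc_left tYZ tYZ_K tZK tY_ZK (tY_ZK y (tZK z k)) = tYZ_K (tYZ y z) k"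
proof -
  note YZ_D = module_tensorD[OF YZ] and YZ_K_D = hilbert_tensorD[OF YZ_K]
    and ZK_D = hilbert_tensorD[OF ZK] and Y_ZK_D = hilbert_tensorD[OF Y_ZK]
  note ind = hilbert_induced[OF Z \<pi> ZK]
  define g where "g = (\<lambda>(y, z, k). tYZ_K (tYZ y z) k)"
  define f where "f = (\<lambda>(y, z, k). tY_ZK y (tZK z k))"
  have g_dense: "closure (span (range g)) = UNIV"
    unfolding g_def
    by (rule dense_tensor_left[OF YZ_D(5) YZ_K_D(3) hilbert_tensor_bounded_linear(1)[OF YZ_D(1) \<pi> YZ_K]])
  have f_dense: "closure (span (range f)) = UNIV"
    unfolding f_def
    by (rule dense_tensor_right[OF ZK_D(3) Y_ZK_D(3) hilbert_tensor_bounded_linear(2)[OF Y ind(3) Y_ZK]])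
  have gram: "cinner (f i) (f j) = cinner (g i) (g j)" for i j
    by (simp add: f_def g_def split_beta Y_ZK_D(2) ind(2) ZK_D(2) YZ_K_D(2) YZ_D(3))
  have scale: "\<exists>j. g j = c *\<^sub>C g i \<and> f j = c *\<^sub>C f i" for c i
    by (rule exI[of _ "(c *\<^sub>C fst i, snd i)"])
       (simp add: f_def g_def split_beta cbilinear_scaleC_left[OF YZ_D(2)]
         cbilinear_scaleC_left[OF YZ_K_D(1)] cbilinear_scaleC_left[OF Y_ZK_D(1)])
  have scale': "\<exists>j. f j = c *\<^sub>C f i \<and> g j = c *\<^sub>C g i" for c i using scale by blast
  obtain T where T: "unitary_op T" "\<And>i. T (g i) = f i"
    using unitary_extension[OF g_dense f_dense scale gram] by blast
  have Tb: "T \<in> bounded_ops" using T(1) by (simp add: unitary_op_def)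
  have T_gen: "T (tYZ_K (tYZ y z) k) = tY_ZK y (tZK z k)" for y z k
    using T(2)[of "(y, z, k)"] by (simp add: f_def g_def)
  have "assoc_right tYZ tYZ_K tZK tY_ZK = T"
    unfolding assoc_right_def
    by (rule the_equality, use Tb T_gen in blast, rule blinfun_eq_on_dense[OF g_dense])
       (auto simp: g_def T_gen)
  then show "unitary_op (assoc_right tYZ tYZ_K tZK tY_ZK)"
    "assoc_right tYZ tYZ_K tZK tY_ZK (tYZ_K (tYZ y z) k) = tY_ZK y (tZK z k)"
    using T(1) T_gen by simp_all
  obtain S where S: "unitary_op S" "\<And>i. S (f i) = g i"
    using unitary_extension[OF f_dense g_dense scale' gram[symmetric]] by blast
  have Sb: "S \<in> bounded_ops" using S(1) by (simp add: unitary_op_def)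
  have S_gen: "S (tY_ZK y (tZK z k)) = tYZ_K (tYZ y z) k" for y z k
    using S(2)[of "(y, z, k)"] by (simp add: f_def g_def)
  have "assoc_left tYZ tYZ_K tZK tY_ZK = S"
    unfolding assoc_left_def
    by (rule the_equality, use Sb S_gen in blast, rule blinfun_eq_on_dense[OF f_dense])
       (auto simp: f_def S_gen)
  then show "unitary_op (assoc_left tYZ tYZ_K tZK tY_ZK)"
    "assoc_left tYZ tYZ_K tZK tY_ZK (tY_ZK y (tZK z k)) = tYZ_K (tYZ y z) k"
    using S(1) S_gen by simp_all
qed

lemma tensor_iso_unitary:
  assumes W: "correspondence_iso \<phi> ract ip \<phi>' ract' ip' W"
    and t: "hilbert_tensor ip \<pi> t" and t': "hilbert_tensor ip' \<pi> t'"
  shows "unitary_op (tensor_op t t' W id_blinfun)"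
    and "tensor_op t t' W id_blinfun (t y k) = t' (W y) k"
proof -
  note D = hilbert_tensorD[OF t] and D' = hilbert_tensorD[OF t']
  have Wb: "W \<in> bounded_ops" and W_surj: "surj (blinfun_apply W)"
    and W_ip: "\<And>x y. ip' (W x) (W y) = ip x y"
    using W unfolding correspondence_iso_def bij_def by blast+
  \<comment> \<open>Surjectivity of W makes the images exhaust the elementary tensors of the target,
    so their span is dense.\<close>
  have range_eq: "range (\<lambda>(y, k). t' (W y) k) = {t' y k |y k. True}"
  proof
    show "{t' y k |y k. True} \<subseteq> range (\<lambda>(y, k). t' (W y) k)"
    proof clarify
      fix y k
      obtain x where "y = W x" using W_surj by blast
      then show "t' y k \<in> range (\<lambda>(y, k). t' (W y) k)" by (intro image_eqI[of _ _ "(x, k)"]) simp_all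
    qed
  qed auto
  have "\<exists>T. unitary_op T \<and> (\<forall>i. T (case_prod t i) = (\<lambda>(y, k). t' (W y) k) i)"
  proof (rule unitary_extension)
    show "closure (span (range (case_prod t))) = UNIV" unfolding tensor_range by (rule D(3))
    show "closure (span (range (\<lambda>(y, k). t' (W y) k))) = UNIV" unfolding range_eq by (rule D'(3))
    show "\<exists>j. case_prod t j = c *\<^sub>C case_prod t i \<and>
        (\<lambda>(y, k). t' (W y) k) j = c *\<^sub>C (\<lambda>(y, k). t' (W y) k) i" for c i
      by (rule exI[of _ "(c *\<^sub>C fst i, snd i)"])
         (simp add: split_beta cbilinear_scaleC_left[OF D(1)] cbilinear_scaleC_left[OF D'(1)]
           bounded_ops_scaleC[OF Wb])
  qed (auto simp: D(2) D'(2) W_ip)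
  then obtain T where T: "unitary_op T" "\<And>y k. T (t y k) = t' (W y) k" by auto
  have "tensor_op t t' W id_blinfun = T"
    by (rule tensor_op_eq[OF D(3)]) (use T in \<open>simp_all add: unitary_op_def\<close>)
  then show "unitary_op (tensor_op t t' W id_blinfun)" "tensor_op t t' W id_blinfun (t y k) = t' (W y) k"
    using T by simp_all
qed

section \<open>The Morita transfer\<close>

text \<open>Adjoints reverse the intertwining relation, so the ball consists of contractive
  intertwiners from Y \<otimes> K to K, and the transfer can be studied without returning to
  z.\<close>

lemma dual_adj_ball_iff:
  assumes \<pi>: "star_representation \<pi>" and ind: "star_representation (induced t \<phi>)"
  shows "Z \<in> dual_adj_ball \<pi> \<phi> t \<longleftrightarrow>
    Z \<in> bounded_ops \<and> norm Z \<le> 1 \<and> (\<forall>a. Z o\<^sub>L induced t \<phi> a = \<pi> a o\<^sub>L Z)"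
proof
  assume "Z \<in> dual_adj_ball \<pi> \<phi> t"
  then obtain z where "z \<in> bounded_ops" "\<And>a. z o\<^sub>L \<pi> a = induced t \<phi> a o\<^sub>L z" "Z = hadj z" "norm Z \<le> 1"
    unfolding dual_adj_ball_def dual_def by auto
  then show "Z \<in> bounded_ops \<and> norm Z \<le> 1 \<and> (\<forall>a. Z o\<^sub>L induced t \<phi> a = \<pi> a o\<^sub>L Z)"
    using intertwiner_adjoint[OF \<pi> ind] by (simp add: hadj_bounded_ops)
next
  assume Z: "Z \<in> bounded_ops \<and> norm Z \<le> 1 \<and> (\<forall>a. Z o\<^sub>L induced t \<phi> a = \<pi> a o\<^sub>L Z)"
  then have "hadj Z \<in> dual \<pi> \<phi> t"
    using intertwiner_adjoint[OF ind \<pi>] by (simp add: dual_def hadj_bounded_ops)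
  moreover have "Z = hadj (hadj Z)" using Z by (simp add: hadj_hadj)
  ultimately show "Z \<in> dual_adj_ball \<pi> \<phi> t"
    unfolding dual_adj_ball_def using Z by (auto simp: dist_norm)
qed

lemma norm_compose_unitary:
  assumes "unitary_op U"
  shows "norm (T o\<^sub>L U) = norm T"
proof -
  obtain V where V: "U o\<^sub>L V = id_blinfun" using assms unfolding unitary_op_def by blast
  have U: "norm (U x) = norm x" for x using assms unfolding unitary_op_def by blast
  show ?thesis
  proof (rule antisym)
    show "norm (T o\<^sub>L U) \<le> norm T"
      by (rule norm_blinfun_bound) (use norm_blinfun[of T] U in \<open>simp_all, metis\<close>)
    show "norm T \<le> norm (T o\<^sub>L U)"
    proof (rule norm_blinfun_bound)
      fix x
      have x: "U (V x) = x" using V by (metis blinfun_apply_blinfun_compose blinfun_apply_id_blinfun)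
      then show "norm (T x) \<le> norm (T o\<^sub>L U) * norm x"
        using norm_blinfun[of "T o\<^sub>L U" "V x"] U[of "V x"] by simp
    qed simp
  qed
qed

text \<open>On nondegeneracy: an intertwiner respects the essential subspaces, i.e. the closed spans
  of all \<pi> a k, and their orthogonal complements; X \<otimes> - annihilates the complements. If
  both complements were nonzero, some nonzero Z between them would be transferred to 0, against
  isometry. Either alternative of the hypothesis makes one complement vanish.\<close>

theorem theorem5:
  fixes \<phi>M :: "'m::cstar_algebra \<Rightarrow> ('e::cbanach \<Rightarrow>\<^sub>L 'e)"
    and ractE :: "'e \<Rightarrow> 'm \<Rightarrow> 'e" and ipE :: "'e \<Rightarrow> 'e \<Rightarrow> 'm"
    and \<phi>N :: "'n::cstar_algebra \<Rightarrow> ('f::cbanach \<Rightarrow>\<^sub>L 'f)"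
    and ractF :: "'f \<Rightarrow> 'n \<Rightarrow> 'f" and ipF :: "'f \<Rightarrow> 'f \<Rightarrow> 'n"
    and \<phi>X :: "'m \<Rightarrow> ('x::cbanach \<Rightarrow>\<^sub>L 'x)"
    and ractX :: "'x \<Rightarrow> 'n \<Rightarrow> 'x" and ipX :: "'x \<Rightarrow> 'x \<Rightarrow> 'n"
    and tEX :: "'e \<Rightarrow> 'x \<Rightarrow> 'ex::cbanach"
    and ractEX :: "'ex \<Rightarrow> 'n \<Rightarrow> 'ex" and ipEX :: "'ex \<Rightarrow> 'ex \<Rightarrow> 'n"
    and tXF :: "'x \<Rightarrow> 'f \<Rightarrow> 'xf::cbanach"
    and ractXF :: "'xf \<Rightarrow> 'n \<Rightarrow> 'xf" and ipXF :: "'xf \<Rightarrow> 'xf \<Rightarrow> 'n"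
    and W :: "'ex \<Rightarrow>\<^sub>L 'xf"
    and \<sigma> :: "'n \<Rightarrow> ('h::chilbert_space \<Rightarrow>\<^sub>L 'h)"
    and tXH :: "'x \<Rightarrow> 'h \<Rightarrow> 'xh::chilbert_space"
    and tFH :: "'f \<Rightarrow> 'h \<Rightarrow> 'fh::chilbert_space"
    and tE_XH :: "'e \<Rightarrow> 'xh \<Rightarrow> 'e_xh::chilbert_space"
    and tEX_H :: "'ex \<Rightarrow> 'h \<Rightarrow> 'ex_h::chilbert_space"
    and tXF_H :: "'xf \<Rightarrow> 'h \<Rightarrow> 'xf_h::chilbert_space"
    and tX_FH :: "'x \<Rightarrow> 'fh \<Rightarrow> 'x_fh::chilbert_space"
  assumes E: "correspondence \<phi>M ractE ipE"
    and F: "correspondence \<phi>N ractF ipF"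
    and X: "equivalence_bimodule \<phi>X ractX ipX"
    and EX: "module_tensor ipE \<phi>X ractX ipX tEX ractEX ipEX"
    and XF: "module_tensor ipX \<phi>N ractF ipF tXF ractXF ipXF"
    and W: "correspondence_iso (induced tEX \<phi>M) ractEX ipEX (induced tXF \<phi>X) ractXF ipXF W"
    and \<sigma>: "star_representation \<sigma>"
    and nondegenerate: "nondegenerate \<sigma> \<or> nondegenerate \<phi>N"
    and XH: "hilbert_tensor ipX \<sigma> tXH"
    and FH: "hilbert_tensor ipF \<sigma> tFH"
    and E_XH: "hilbert_tensor ipE (induced tXH \<phi>X) tE_XH"
    and EX_H: "hilbert_tensor ipEX \<sigma> tEX_H"
    and XF_H: "hilbert_tensor ipXF \<sigma> tXF_H"
    and X_FH: "hilbert_tensor ipX (induced tFH \<phi>N) tX_FH"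
  shows "let ballF = dual_adj_ball \<sigma> \<phi>N tFH;
             ballE = dual_adj_ball (induced tXH \<phi>X) \<phi>M tE_XH;
             W_I = assoc_right tXF tXF_H tFH tX_FH o\<^sub>L tensor_op tEX_H tXF_H W id_blinfun
                     o\<^sub>L assoc_left tEX tEX_H tXH tE_XH;
             transfer = (\<lambda>Z. tensor_op tX_FH tXH id_blinfun Z o\<^sub>L W_I)
         in (\<forall>Z\<in>ballF. transfer Z \<in> ballE) \<and>
            (\<forall>Z1\<in>ballF. \<forall>Z2\<in>ballF. dist (transfer Z1) (transfer Z2) = dist Z1 Z2) \<and>
            transfer ` ballF = ballE"
proof -
  have X_corr: "correspondence \<phi>X ractX ipX" using X unfolding equivalence_bimodule_def by blast
  note H_E = correspondenceD(1)[OF E] and H_X = correspondenceD(1)[OF X_corr]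
  note ind_XH = hilbert_induced[OF X_corr \<sigma> XH]
  note ind_FH = hilbert_induced[OF F \<sigma> FH]
  note ind_E_XH = hilbert_induced[OF E ind_XH(3) E_XH]
  note ind_X_FH = hilbert_induced[OF X_corr ind_FH(3) X_FH]
  note EX_D = module_tensorD[OF EX] and XF_D = module_tensorD[OF XF]
  have nondeg: "nondegenerate (induced tFH \<phi>N) \<or> nondegenerate \<sigma>"
    using nondegenerate nondegenerate_induced[OF F \<sigma> FH] by blast
  define ballF where "ballF = dual_adj_ball \<sigma> \<phi>N tFH"
  define ballE where "ballE = dual_adj_ball (induced tXH \<phi>X) \<phi>M tE_XH"
  define U1 where "U1 = assoc_left tEX tEX_H tXH tE_XH"
  define U2 where "U2 = tensor_op tEX_H tXF_H W id_blinfun"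
  define U3 where "U3 = assoc_right tXF tXF_H tFH tX_FH"
  define U where "U = U3 o\<^sub>L U2 o\<^sub>L U1"
  define I where "I = (\<lambda>Z. tensor_op tX_FH tXH id_blinfun Z)"
  note ballF_iff = dual_adj_ball_iff[OF \<sigma> ind_FH(3), folded ballF_def]
  note ballE_iff = dual_adj_ball_iff[OF ind_XH(3) ind_E_XH(3), folded ballE_def]
  have U1: "unitary_op U1" "U1 (tE_XH e (tXH x h)) = tEX_H (tEX e x) h" for e x h
    unfolding U1_def by (rule assoc_unitary[OF H_E X_corr EX \<sigma> EX_H XH E_XH])+
  have U2: "unitary_op U2" "U2 (tEX_H w h) = tXF_H (W w) h" for w h
    unfolding U2_def by (rule tensor_iso_unitary[OF W EX_H XF_H])+
  have U3: "unitary_op U3" "U3 (tXF_H (tXF x f) h) = tX_FH x (tFH f h)" for x f h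
    unfolding U3_def by (rule assoc_unitary[OF H_X F XF \<sigma> XF_H FH X_FH])+
  have unitary: "unitary_op U" unfolding U_def by (intro unitary_op_compose U1 U2 U3)
  \<comment> \<open>W (e \<otimes> x) need not be an elementary tensor, so commutation is needed for
    arbitrary w in X \<otimes> F and is obtained by density.\<close>
  have U3_comm: "U3 (tXF_H (induced tXF \<phi>X a w) h) = induced tX_FH \<phi>X a (U3 (tXF_H w h))" for a w h
  proof (rule bounded_linear_eq_on_dense[OF XF_D(5)])
    note bl = hilbert_tensor_bounded_linear(1)[OF XF_D(1) \<sigma> XF_H, of h]
    note apply_bl = bounded_linear_compose[OF blinfun.bounded_linear_right]
    show "bounded_linear (\<lambda>w. U3 (tXF_H (induced tXF \<phi>X a w) h))"
      by (intro apply_bl bounded_linear_compose[OF bl] blinfun.bounded_linear_right)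
    show "bounded_linear (\<lambda>w. induced tX_FH \<phi>X a (U3 (tXF_H w h)))"
      by (intro apply_bl bl)
    show "U3 (tXF_H (induced tXF \<phi>X a w) h) = induced tX_FH \<phi>X a (U3 (tXF_H w h))"
      if "w \<in> {tXF x f |x f. True}" for w
      using that by (auto simp: module_induced[OF X_corr F XF] U3(2) ind_X_FH(2))
  qed
  have W_comm: "W (induced tEX \<phi>M a w) = induced tXF \<phi>X a (W w)" for a w
    using W unfolding correspondence_iso_def by blast
  have U_comm: "U o\<^sub>L induced tE_XH \<phi>M a = induced tX_FH \<phi>X a o\<^sub>L U" for a
  proof (rule blinfun_eq_on_dense[OF dense_tensor_right[OF hilbert_tensorD(3)[OF XH] hilbert_tensorD(3)[OF E_XH]
        hilbert_tensor_bounded_linear(2)[OF H_E ind_XH(3) E_XH]]], clarify)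
    fix e x h
    have "U (induced tE_XH \<phi>M a (tE_XH e (tXH x h))) = U3 (U2 (tEX_H (tEX (\<phi>M a e) x) h))"
      by (simp add: U_def ind_E_XH(2) U1(2))
    also have "\<dots> = U3 (tXF_H (W (induced tEX \<phi>M a (tEX e x))) h)"
      by (simp add: U2(2) module_induced[OF E X_corr EX])
    also have "\<dots> = induced tX_FH \<phi>X a (U (tE_XH e (tXH x h)))"
      by (simp add: W_comm U3_comm U_def U1(2) U2(2))
    finally show "(U o\<^sub>L induced tE_XH \<phi>M a) (tE_XH e (tXH x h))
      = (induced tX_FH \<phi>X a o\<^sub>L U) (tE_XH e (tXH x h))" by simp
  qed
  have I: "I Z \<in> bounded_ops" "I Z (tX_FH x v) = tXH x (Z v)"
    "I Z o\<^sub>L induced tX_FH \<phi>X a = induced tXH \<phi>X a o\<^sub>L I Z" "norm (I Z) = norm Z"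
    if "Z \<in> bounded_ops" "\<And>a. Z o\<^sub>L induced tFH \<phi>N a = \<sigma> a o\<^sub>L Z" for Z a x v
    unfolding I_def
    by (rule ampliation[OF H_X ind_FH(3) X_FH \<sigma> XH that]
        norm_ampliation[OF X ind_FH(3) X_FH \<sigma> XH nondeg that])+
  have into: "I Z o\<^sub>L U \<in> ballE" if "Z \<in> ballF" for Z
  proof -
    have Z: "Z \<in> bounded_ops" "\<And>a. Z o\<^sub>L induced tFH \<phi>N a = \<sigma> a o\<^sub>L Z" "norm Z \<le> 1"
      using that unfolding ballF_iff by blast+
    have "(I Z o\<^sub>L U) o\<^sub>L induced tE_XH \<phi>M a = induced tXH \<phi>X a o\<^sub>L (I Z o\<^sub>L U)" for a
    proof -
      have "(I Z o\<^sub>L U) o\<^sub>L induced tE_XH \<phi>M a = (I Z o\<^sub>L induced tX_FH \<phi>X a) o\<^sub>L U"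
        by (simp add: blinfun_compose_assoc U_comm)
      then show ?thesis by (simp add: I(3)[OF Z(1,2)] blinfun_compose_assoc)
    qed
    then show ?thesis
      unfolding ballE_iff
      using unitary by (simp add: bounded_ops_compose I(1)[OF Z(1,2)] norm_compose_unitary I(4)[OF Z(1,2)] Z(3)
          unitary_op_def)
  qed
  have isometric: "dist (I Z1 o\<^sub>L U) (I Z2 o\<^sub>L U) = dist Z1 Z2" if "Z1 \<in> ballF" "Z2 \<in> ballF" for Z1 Z2
  proof -
    have Z: "Z1 \<in> bounded_ops" "\<And>a. Z1 o\<^sub>L induced tFH \<phi>N a = \<sigma> a o\<^sub>L Z1"
      "Z2 \<in> bounded_ops" "\<And>a. Z2 o\<^sub>L induced tFH \<phi>N a = \<sigma> a o\<^sub>L Z2"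
      using that unfolding ballF_iff by blast+
    \<comment> \<open>The difference may leave the ball but is still an intertwiner, and the norm
      formula for \<open>I\<close> holds for all of these.\<close>
    have D: "Z1 - Z2 \<in> bounded_ops" "\<And>a. (Z1 - Z2) o\<^sub>L induced tFH \<phi>N a = \<sigma> a o\<^sub>L (Z1 - Z2)"
      using Z by (simp_all add: bounded_ops_diff bounded_bilinear.diff_left[OF bounded_bilinear_blinfun_compose] bounded_bilinear.diff_right[OF bounded_bilinear_blinfun_compose])
    have "I (Z1 - Z2) = I Z1 - I Z2"
      by (rule blinfun_eq_on_dense[OF hilbert_tensorD(3)[OF X_FH]])
         (auto simp: I(2)[OF Z(1,2)] I(2)[OF Z(3,4)] I(2)[OF D] blinfun.diff_left
           linear_diff[OF bounded_linear.linear[OF hilbert_tensor_bounded_linear(2)[OF H_X \<sigma> XH]]])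
    then have "(I Z1 o\<^sub>L U) - (I Z2 o\<^sub>L U) = I (Z1 - Z2) o\<^sub>L U" by (simp add: bounded_bilinear.diff_left[OF bounded_bilinear_blinfun_compose])
    then show ?thesis
      by (simp add: dist_norm norm_compose_unitary[OF unitary] I(4)[OF D])
  qed
  have onto: "\<exists>Z\<in>ballF. T = I Z o\<^sub>L U" if "T \<in> ballE" for T
  proof -
    have T: "T \<in> bounded_ops" "norm T \<le> 1" "\<And>a. T o\<^sub>L induced tE_XH \<phi>M a = induced tXH \<phi>X a o\<^sub>L T"
      using that unfolding ballE_iff by blast+
    obtain V where V: "V \<in> bounded_ops" "U o\<^sub>L V = id_blinfun" "V o\<^sub>L U = id_blinfun"
      using unitary unfolding unitary_op_def by blast
    have TVU: "T o\<^sub>L V o\<^sub>L U = T" by (simp add: blinfun_compose_assoc V(3))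
    \<comment> \<open>The inverse of U intertwines in the opposite direction, so T after V maps X
      \<otimes> (F \<otimes> H) to X \<otimes> H and intertwines the actions of M, as imprimitivity
      requires.\<close>
    have V_comm: "V o\<^sub>L induced tX_FH \<phi>X a = induced tE_XH \<phi>M a o\<^sub>L V" for a
    proof -
      have "V o\<^sub>L induced tX_FH \<phi>X a = V o\<^sub>L (induced tX_FH \<phi>X a o\<^sub>L U) o\<^sub>L V"
        by (simp add: blinfun_compose_assoc V(2))
      also have "\<dots> = (V o\<^sub>L U) o\<^sub>L induced tE_XH \<phi>M a o\<^sub>L V"
        by (simp add: U_comm[symmetric] blinfun_compose_assoc)
      finally show ?thesis by (simp add: V(3))
    qed
    have "T o\<^sub>L V o\<^sub>L induced tX_FH \<phi>X a = induced tXH \<phi>X a o\<^sub>L (T o\<^sub>L V)" for a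
      by (metis V_comm T(3) blinfun_compose_assoc)
    from imprimitivity_nondegenerate_either[OF X ind_FH(3) X_FH \<sigma> XH nondeg bounded_ops_compose[OF T(1) V(1)] this]
    obtain Z where Z: "Z \<in> bounded_ops" "norm Z \<le> norm (T o\<^sub>L V)"
      "\<And>a. Z o\<^sub>L induced tFH \<phi>N a = \<sigma> a o\<^sub>L Z" "\<And>x v. (T o\<^sub>L V) (tX_FH x v) = tXH x (Z v)"
      by blast
    have "I Z = T o\<^sub>L V"
      by (rule blinfun_eq_on_dense[OF hilbert_tensorD(3)[OF X_FH]])
         (auto simp: I(2)[OF Z(1,3)] Z(4)[unfolded blinfun_apply_blinfun_compose])
    moreover have "norm (T o\<^sub>L V) = norm T"
      using norm_compose_unitary[OF unitary, of "T o\<^sub>L V"] TVU by simp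
    moreover from this have "Z \<in> ballF"
      unfolding ballF_iff using Z T(2) by auto
    ultimately show ?thesis using TVU by (intro bexI[of _ Z]) simp_all
  qed
  have "(\<lambda>Z. I Z o\<^sub>L U) ` ballF = ballE" using into onto by blast
  then show ?thesis
    unfolding Let_def using into isometric
    unfolding ballF_def ballE_def U_def U1_def U2_def U3_def I_def by blast
qed

end
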